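(* There is an algorithm to decide, for an arbitrary given affine pair of communicating SR-machines, whether the protocol is (simultaneously) deadlock-free and has the bounded channel property.
   Context: A pair of communicating SR-machines is a CFSM protocol with communication graph having nodes $\{0,1\}$ and two edges $\alpha$ (from $0$ to $1$) and $\beta$ (from $1$ to $0$), disjoint finite message alphabets $M_\alpha,M_\beta$, and two finite state machines $F_j=(K_j,\Sigma_j,T_j,h_j)$, $j=0,1$, with $\Sigma_0=\{-b:b\in M_\alpha\}\cup\{+b:b\in M_\beta\}$, $\Sigma_1=\{-b:b\in M_\beta\}\cup\{+b:b\in M_\alpha\}$, $K_j$ finite, $h_j\in K_j$ initial, $T_j\subseteq K_j\times\Sigma_j\times K_j$ (transitions $p\xrightarrow{e}q$; $+b$ = receive, $-b$ = send; $p\xrightarrow{w}q$ means a directed path labelled $w$). A send state has no outgoing $+b$ transition, a receive state no outgoing $-b$ transition. $F_j$ is an SR-machine if every state is a send or a receive state, its transition diagram is strongly connected, and it is deterministic ($p\xrightarrow{e}q_1$, $p\xrightarrow{e}q_2$ imply $q_1=q_2$). Global states are $((p_0,p_1),(x_\alpha,x_\beta))$; initially $((h_0,h_1),(\lambda,\lambda))$. A step is a send (a machine performs $p\xrightarrow{-b}q$ and $b$ is appended to its output channel: $\alpha$ for $F_0$, $\beta$ for $F_1$) or a receive (a machine performs $p\xrightarrow{+b}q$ and $b$ is removed from the front of its input channel, which must begin with $b$); the other machine is unchanged. A global state is deadlocked if both components are receive states and both channels are empty; deadlock-free means no reachable deadlocked global state. The bounded channel property means $|x_\alpha|+|x_\beta|$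 is bounded over all reachable global states. $\pi_\alpha(w)$ (resp. $\pi_\beta(w)$) is the string of $M_\alpha$- (resp. $M_\beta$-) symbols in $w$, in order, signs removed; $\mathbf Z_j=\{(\pi_\alpha(w),\pi_\beta(w)): h_j\xrightarrow{w}h_j\}$; the pair is affine if $\mathbf Z_0=\mathbf Z_1$. *)

theory Defs
  imports Main "HOL-Library.Nat_Bijection"
begin

section \<open>Computability: partial mu-recursive functions on nat\<close>

datatype recf = Zero | Succ | Proj nat | Comp recf "recf list" | Prim recf recf | Mu recf

text \<open>reval f xs y: the mu-recursive program f, run on argument list xs,
  halts with output y.\<close>
inductive reval :: "recf \<Rightarrow> nat list \<Rightarrow> nat \<Rightarrow> bool" where
  reval_Zero: "reval Zero xs 0"
| reval_Succ: "reval Succ (x # xs) (Suc x)"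
| reval_Proj: "i < length xs \<Longrightarrow> reval (Proj i) xs (xs ! i)"
| reval_Comp: "length ys = length gs \<Longrightarrow> (\<forall>i<length gs. reval (gs ! i) xs (ys ! i))
     \<Longrightarrow> reval f ys z \<Longrightarrow> reval (Comp f gs) xs z"
| reval_Prim0: "reval f xs z \<Longrightarrow> reval (Prim f g) (0 # xs) z"
| reval_PrimS: "reval (Prim f g) (n # xs) y \<Longrightarrow> reval g (y # n # xs) z
     \<Longrightarrow> reval (Prim f g) (Suc n # xs) z"
| reval_Mu: "reval f (n # xs) 0 \<Longrightarrow> (\<forall>m<n. \<exists>k. reval f (m # xs) (Suc k))
     \<Longrightarrow> reval (Mu f) xs n"

section \<open>Pairs of communicating SR-machines (concrete representation)\<close>

text \<open>A transition (p, (s, b), q): s = True means the send event -b,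
  s = False means the receive event +b. States and messages are naturals.\<close>
type_synonym trans = "nat \<times> (bool \<times> nat) \<times> nat"

datatype fsm = FSM (states: "nat list") (init: nat) (trans: "trans list")

text \<open>SRPair Malpha Mbeta F0 F1: channel alpha goes from F0 to F1, beta from F1 to F0.\<close>
datatype sr_pair = SRPair (Malpha: "nat list") (Mbeta: "nat list") (mach0: fsm) (mach1: fsm)

definition send_state :: "fsm \<Rightarrow> nat \<Rightarrow> bool" where
  "send_state F p \<longleftrightarrow> (\<nexists>b q. (p, (False, b), q) \<in> set (trans F))"

definition receive_state :: "fsm \<Rightarrow> nat \<Rightarrow> bool" where
  "receive_state F p \<longleftrightarrow> (\<nexists>b q. (p, (True, b), q) \<in> set (trans F))"

text \<open>Well-formed FSM over alphabet with outgoing messages Out and incoming messages In.\<close>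
definition wf_fsm :: "nat list \<Rightarrow> nat list \<Rightarrow> fsm \<Rightarrow> bool" where
  "wf_fsm Out In F \<longleftrightarrow> init F \<in> set (states F) \<and>
     (\<forall>(p, (s, b), q) \<in> set (trans F). p \<in> set (states F) \<and> q \<in> set (states F) \<and>
        (s \<longrightarrow> b \<in> set Out) \<and> (\<not> s \<longrightarrow> b \<in> set In))"

definition is_SR_machine :: "nat list \<Rightarrow> nat list \<Rightarrow> fsm \<Rightarrow> bool" where
  "is_SR_machine Out In F \<longleftrightarrow> wf_fsm Out In F \<and>
     (\<forall>p \<in> set (states F). send_state F p \<or> receive_state F p) \<and>
     (\<forall>p \<in> set (states F). \<forall>q \<in> set (states F).
        (p, q) \<in> {(p', q'). \<exists>e. (p', e, q') \<in> set (trans F)}\<^sup>*) \<and>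
     (\<forall>p e q1 q2. (p, e, q1) \<in> set (trans F) \<longrightarrow> (p, e, q2) \<in> set (trans F) \<longrightarrow> q1 = q2)"

definition is_SR_pair :: "sr_pair \<Rightarrow> bool" where
  "is_SR_pair P \<longleftrightarrow> set (Malpha P) \<inter> set (Mbeta P) = {} \<and>
     is_SR_machine (Malpha P) (Mbeta P) (mach0 P) \<and>
     is_SR_machine (Mbeta P) (Malpha P) (mach1 P)"

text \<open>Directed paths p --w--> q in the transition diagram.\<close>
inductive path :: "fsm \<Rightarrow> nat \<Rightarrow> (bool \<times> nat) list \<Rightarrow> nat \<Rightarrow> bool" for F where
  path_nil: "path F p [] p"
| path_cons: "(p, e, r) \<in> set (trans F) \<Longrightarrow> path F r w q \<Longrightarrow> path F p (e # w) q"

definition proj :: "nat list \<Rightarrow> (bool \<times> nat) list \<Rightarrow> nat list" where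
  "proj M w = map snd (filter (\<lambda>e. snd e \<in> set M) w)"

definition Zset :: "sr_pair \<Rightarrow> fsm \<Rightarrow> (nat list \<times> nat list) set" where
  "Zset P F = {(proj (Malpha P) w, proj (Mbeta P) w) | w. path F (init F) w (init F)}"

definition affine :: "sr_pair \<Rightarrow> bool" where
  "affine P \<longleftrightarrow> Zset P (mach0 P) = Zset P (mach1 P)"

section \<open>Global semantics\<close>

type_synonym gstate = "(nat \<times> nat) \<times> (nat list \<times> nat list)"

inductive gstep :: "sr_pair \<Rightarrow> gstate \<Rightarrow> gstate \<Rightarrow> bool" for P where
  send0: "(p0, (True, b), q) \<in> set (trans (mach0 P)) \<Longrightarrow>
     gstep P ((p0, p1), (xa, xb)) ((q, p1), (xa @ [b], xb))"
| recv0: "(p0, (False, b), q) \<in> set (trans (mach0 P)) \<Longrightarrow>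
     gstep P ((p0, p1), (xa, b # xb)) ((q, p1), (xa, xb))"
| send1: "(p1, (True, b), q) \<in> set (trans (mach1 P)) \<Longrightarrow>
     gstep P ((p0, p1), (xa, xb)) ((p0, q), (xa, xb @ [b]))"
| recv1: "(p1, (False, b), q) \<in> set (trans (mach1 P)) \<Longrightarrow>
     gstep P ((p0, p1), (b # xa, xb)) ((p0, q), (xa, xb))"

definition initial_gstate :: "sr_pair \<Rightarrow> gstate" where
  "initial_gstate P = ((init (mach0 P), init (mach1 P)), ([], []))"

definition reachable :: "sr_pair \<Rightarrow> gstate \<Rightarrow> bool" where
  "reachable P c \<longleftrightarrow> (gstep P)\<^sup>*\<^sup>* (initial_gstate P) c"

definition deadlocked :: "sr_pair \<Rightarrow> gstate \<Rightarrow> bool" where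
  "deadlocked P c \<longleftrightarrow> receive_state (mach0 P) (fst (fst c)) \<and>
     receive_state (mach1 P) (snd (fst c)) \<and> fst (snd c) = [] \<and> snd (snd c) = []"

definition deadlock_free :: "sr_pair \<Rightarrow> bool" where
  "deadlock_free P \<longleftrightarrow> (\<forall>c. reachable P c \<longrightarrow> \<not> deadlocked P c)"

definition bounded_channels :: "sr_pair \<Rightarrow> bool" where
  "bounded_channels P \<longleftrightarrow>
     (\<exists>N. \<forall>c. reachable P c \<longrightarrow> length (fst (snd c)) + length (snd (snd c)) \<le> N)"

section \<open>Encoding of instances as natural numbers\<close>

definition encode_trans :: "trans \<Rightarrow> nat" where
  "encode_trans t = (case t of (p, (s, b), q) \<Rightarrow> list_encode [p, if s then 1 else 0, b, q])"

definition encode_fsm :: "fsm \<Rightarrow> nat" where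
  "encode_fsm F = list_encode [list_encode (states F), init F, list_encode (map encode_trans (trans F))]"

definition encode_pair :: "sr_pair \<Rightarrow> nat" where
  "encode_pair P = list_encode [list_encode (Malpha P), list_encode (Mbeta P),
      encode_fsm (mach0 P), encode_fsm (mach1 P)]"

end

theory Submission
  imports Defs
begin

text \<open>Call a path of a machine a run if it consists of send events only or of receive events only.
  If an affine pair has arbitrarily long send runs and is deadlock-free, then every state of either
  machine occurs in a reachable global state: a loop through it has a dual loop in the other machine,
  and both can be scheduled together. Hence some machine can fill its output channel without bound.
  Conversely, if send runs are bounded in both machines, then by duality of loops so are receive runs,
  and comparing a path of one machine with the loop dual to a completion of the other machine's path
  bounds both channels.

  So an affine pair fails to be deadlock-free with bounded channels iff a deadlock is reachable or one
  of the machines has a send cycle, both of which have finite certificates; a finite set of global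
  states that is closed under steps and contains no deadlock certifies the positive answer.
  The algorithm searches for a certificate of either kind.\<close>

section \<open>Sent and received words\<close>

definition snt :: "(bool \<times> nat) list \<Rightarrow> nat list" where
  "snt w = map snd (filter fst w)"

definition rcv :: "(bool \<times> nat) list \<Rightarrow> nat list" where
  "rcv w = map snd (filter (\<lambda>e. \<not> fst e) w)"

lemma snt_simps [simp]: "snt [] = []" "snt (e # w) = (if fst e then snd e # snt w else snt w)"
  "snt (u @ v) = snt u @ snt v"
  by (auto simp: snt_def)

lemma rcv_simps [simp]: "rcv [] = []" "rcv (e # w) = (if fst e then rcv w else snd e # rcv w)"
  "rcv (u @ v) = rcv u @ rcv v"
  by (auto simp: rcv_def)

lemma length_snt_rcv: "length w = length (snt w) + length (rcv w)"
  by (induction w) auto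

section \<open>Paths and the structure of SR-machines\<close>

lemma path_Nil_iff [simp]: "path F p [] q \<longleftrightarrow> p = q"
  by (auto intro: path_nil elim: path.cases)

lemma path_Cons_iff: "path F p (e # w) q \<longleftrightarrow> (\<exists>r. (p, e, r) \<in> set (trans F) \<and> path F r w q)"
  by (auto intro: path_cons elim: path.cases)

lemma path_append_iff: "path F p (u @ v) q \<longleftrightarrow> (\<exists>r. path F p u r \<and> path F r v q)"
  by (induction u arbitrary: p) (auto simp: path_Cons_iff)

lemma path_snoc: "path F p w q \<Longrightarrow> (q, e, r) \<in> set (trans F) \<Longrightarrow> path F p (w @ [e]) r"
  by (auto simp: path_append_iff path_Cons_iff)

text \<open>Alphabet-free form of the SR conditions, so that one development serves both machines
  although their input and output alphabets are exchanged. \<open>polarity\<close> expresses that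
  every state is a send or a receive state.\<close>

locale sr_fsm =
  fixes F :: fsm
  assumes init_state: "init F \<in> set (states F)"
    and trans_states: "(p, e, q) \<in> set (trans F) \<Longrightarrow> p \<in> set (states F) \<and> q \<in> set (states F)"
    and polarity: "(p, e, q) \<in> set (trans F) \<Longrightarrow> (p, e', q') \<in> set (trans F) \<Longrightarrow> fst e = fst e'"
    and connected: "p \<in> set (states F) \<Longrightarrow> q \<in> set (states F) \<Longrightarrow> \<exists>w. path F p w q"
    and deterministic: "(p, e, q) \<in> set (trans F) \<Longrightarrow> (p, e, q') \<in> set (trans F) \<Longrightarrow> q = q'"

lemma SR_machine_sr_fsm:
  assumes "is_SR_machine Out In F"
  shows "sr_fsm F"
proof
  note A = assms[unfolded is_SR_machine_def wf_fsm_def]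
  show "init F \<in> set (states F)" using A by blast
  show st: "p \<in> set (states F) \<and> q \<in> set (states F)" if "(p, e, q) \<in> set (trans F)" for p e q
    using A that by (cases e) fastforce
  show "fst e = fst e'" if "(p, e, q) \<in> set (trans F)" "(p, e', q') \<in> set (trans F)" for p e q e' q'
  proof -
    have "send_state F p \<or> receive_state F p" using A st[OF that(1)] by blast
    then show ?thesis using that unfolding send_state_def receive_state_def
      by (cases e; cases e') (metis (full_types) fst_conv)
  qed
  show "q = q'" if "(p, e, q) \<in> set (trans F)" "(p, e, q') \<in> set (trans F)" for p e q q'
    using A that by blast
  show "\<exists>w. path F p w q" if "p \<in> set (states F)" "q \<in> set (states F)" for p q
  proof -
    have "(p, q) \<in> {(p', q'). \<exists>e. (p', e, q') \<in> set (trans F)}\<^sup>*" using A that by blast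
    then show ?thesis
    proof (induction rule: rtrancl_induct)
      case base
      show ?case by (auto intro: path_nil)
    next
      case (step y z)
      then show ?case by (blast intro: path_snoc)
    qed
  qed
qed

lemma (in sr_fsm) path_state: "path F p w q \<Longrightarrow> p \<in> set (states F) \<Longrightarrow> q \<in> set (states F)"
  by (induction rule: path.induct) (use trans_states in blast)+

lemma (in sr_fsm) path_deterministic: "path F p w q \<Longrightarrow> path F p w q' \<Longrightarrow> q = q'"
proof (induction arbitrary: q' rule: path.induct)
  case (path_cons p e r w q)
  then show ?case using deterministic unfolding path_Cons_iff by blast
qed simp

text \<open>There are only finitely many pairs of states; fix one connecting path for each and take
  the maximal length.\<close>

lemma (in sr_fsm) connected_bounded:
  "\<exists>C. \<forall>p \<in> set (states F). \<forall>q \<in> set (states F). \<exists>w. path F p w q \<and> length w \<le> C"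
proof -
  obtain W where W: "\<And>p q. p \<in> set (states F) \<Longrightarrow> q \<in> set (states F) \<Longrightarrow> path F p (W p q) q"
    using connected by metis
  let ?C = "Max ((\<lambda>(p, q). length (W p q)) ` (set (states F) \<times> set (states F)))"
  have "length (W p q) \<le> ?C" if "p \<in> set (states F)" "q \<in> set (states F)" for p q
    by (rule Max_ge) (use that in auto)
  then show ?thesis using W by blast
qed

section \<open>Bounded runs and cycles of send transitions\<close>

definition runs_bounded :: "bool \<Rightarrow> fsm \<Rightarrow> nat \<Rightarrow> bool" where
  "runs_bounded s F B \<longleftrightarrow> (\<forall>p w q. path F p w q \<longrightarrow> (\<forall>e \<in> set w. fst e = s) \<longrightarrow> length w \<le> B)"

text \<open>The \<open>k\<close> events of the opposite polarity cut \<open>w\<close> into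
  \<open>k + 1\<close> runs of length at most \<open>B\<close>, so \<open>w\<close> has length at
  most \<open>(k + 1) * B + k\<close>. The induction removes the first run together with the event
  that ends it.\<close>

lemma length_le_opposite_events:
  assumes "runs_bounded s F B" "path F p w q"
  shows "length w \<le> Suc (length (filter (\<lambda>e. fst e \<noteq> s) w)) * Suc B"
  using assms(2)
proof (induction w arbitrary: p rule: length_induct)
  case (1 w)
  define u where "u = takeWhile (\<lambda>e. fst e = s) w"
  define v where "v = dropWhile (\<lambda>e. fst e = s) w"
  have w: "w = u @ v" by (simp add: u_def v_def)
  have us: "\<forall>e \<in> set u. fst e = s" unfolding u_def by (auto dest: set_takeWhileD)
  obtain r where r: "path F p u r" "path F r v q" using 1(2) unfolding w path_append_iff by blast
  have u: "length u \<le> B" using assms(1) r(1) us unfolding runs_bounded_def by blast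
  show ?case
  proof (cases v)
    case Nil
    then have "length w \<le> Suc B" using u unfolding w by simp
    also have "\<dots> \<le> Suc (length (filter (\<lambda>e. fst e \<noteq> s) w)) * Suc B" by simp
    finally show ?thesis .
  next
    case (Cons e v')
    have e: "fst e \<noteq> s" using Cons hd_dropWhile[of "\<lambda>e. fst e = s" w] unfolding v_def
      by (metis list.sel(1) list.distinct(1))
    obtain r' where "path F r' v' q" using r Cons by (auto simp: path_Cons_iff)
    moreover have "length v' < length w" unfolding w Cons by simp
    ultimately have "length v' \<le> Suc (length (filter (\<lambda>e. fst e \<noteq> s) v')) * Suc B"
      using 1(1) by blast
    moreover have "length (filter (\<lambda>e. fst e \<noteq> s) w) \<ge> Suc (length (filter (\<lambda>e. fst e \<noteq> s) v'))"
      using e unfolding w Cons by simp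
    then have "Suc (Suc (length (filter (\<lambda>e. fst e \<noteq> s) v'))) * Suc B \<le>
        Suc (length (filter (\<lambda>e. fst e \<noteq> s) w)) * Suc B"
      by (intro mult_le_mono) auto
    moreover have "length w = length u + Suc (length v')" unfolding w Cons by simp
    ultimately show ?thesis using u by simp
  qed
qed

lemma length_le_received:
  "runs_bounded True F B \<Longrightarrow> path F p w q \<Longrightarrow> length w \<le> Suc (length (rcv w)) * Suc B"
  using length_le_opposite_events[of True F B p w q] by (simp add: rcv_def)

lemma length_le_sent:
  "runs_bounded False F B \<Longrightarrow> path F p w q \<Longrightarrow> length w \<le> Suc (length (snt w)) * Suc B"
  using length_le_opposite_events[of False F B p w q] by (simp add: snt_def)

text \<open>A certificate for the existence of a cycle of send transitions.\<close>
definition send_burst :: "fsm \<Rightarrow> nat set \<Rightarrow> bool" where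
  "send_burst F L \<longleftrightarrow> L \<noteq> {} \<and> (\<forall>p \<in> L. \<exists>b q. (p, (True, b), q) \<in> set (trans F) \<and> q \<in> L)"

lemma send_burst_path:
  assumes "send_burst F L" "p \<in> L"
  shows "\<exists>w q. path F p w q \<and> (\<forall>e \<in> set w. fst e) \<and> length w = n \<and> q \<in> L"
proof (induction n)
  case 0
  show ?case using assms(2) by (intro exI[of _ "[]"]) auto
next
  case (Suc n)
  then obtain w q where w: "path F p w q" "\<forall>e \<in> set w. fst e" "length w = n" "q \<in> L" by blast
  obtain b r where r: "(q, (True, b), r) \<in> set (trans F)" "r \<in> L"
    using assms(1) w(4) unfolding send_burst_def by blast
  show ?case
    by (intro exI[of _ "w @ [(True, b)]"] exI[of _ r]) (use w r path_snoc in auto)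
qed

text \<open>A finite form of Koenig's lemma. The states that start arbitrarily long send runs form a
  burst unless there are none: only finitely many transitions leave such a state, so one of its send
  successors starts arbitrarily long runs as well. If there are none, the finitely many states have
  a common bound.\<close>

lemma (in sr_fsm) no_send_burst_runs_bounded:
  assumes "\<And>L. L \<subseteq> set (states F) \<Longrightarrow> \<not> send_burst F L"
  shows "\<exists>B. runs_bounded True F B"
proof -
  define long where "long p n \<longleftrightarrow> (\<exists>w q. path F p w q \<and> (\<forall>e \<in> set w. fst e) \<and> n \<le> length w)" for p n
  define L where "L = {p \<in> set (states F). \<forall>n. long p n}"
  have mono: "long p m" if "long p n" "m \<le> n" for p m n
    using that unfolding long_def by (meson le_trans)
  have "\<exists>b q. (p, (True, b), q) \<in> set (trans F) \<and> q \<in> L" if p: "p \<in> L" for p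
  proof (rule ccontr)
    assume neg: "\<nexists>b q. (p, (True, b), q) \<in> set (trans F) \<and> q \<in> L"
    let ?S = "{t \<in> set (trans F). fst t = p \<and> fst (fst (snd t))}"
    have "\<exists>n. \<not> long (snd (snd t)) n" if tS: "t \<in> ?S" for t
    proof -
      obtain e q where t: "t = (p, (True, e), q)" using tS by (cases t) auto
      then have "q \<notin> L" "q \<in> set (states F)" using neg tS trans_states by blast+
      then show ?thesis using t by (simp add: L_def)
    qed
    then have "\<forall>t\<in>?S. \<exists>n. \<not> long (snd (snd t)) n" by blast
    from bchoice[OF this] obtain N where N: "\<And>t. t \<in> ?S \<Longrightarrow> \<not> long (snd (snd t)) (N t)" by blast
    \<comment> \<open>\<open>M\<close> is at least every length that fails at a send successor of
      \<open>p\<close>. A run of length \<open>Suc M\<close> from \<open>p\<close> still has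
      \<open>M\<close> events left after its first transition.\<close>
    define M where "M = Max (insert 0 (N ` ?S))"
    have M: "N t \<le> M" if "t \<in> ?S" for t unfolding M_def by (rule Max_ge) (use that in auto)
    obtain w q where w: "path F p w q" "\<forall>e \<in> set w. fst e" "Suc M \<le> length w"
      using p unfolding L_def long_def by blast
    then obtain e w' where e: "w = e # w'" by (cases w) auto
    then obtain r where r: "(p, e, r) \<in> set (trans F)" "path F r w' q"
      using w by (auto simp: path_Cons_iff)
    have t: "(p, e, r) \<in> ?S" using r w e by auto
    have "long r M" unfolding long_def using r w e by auto
    then show False using N[OF t] M[OF t] mono by auto
  qed
  moreover have "L \<subseteq> set (states F)" by (auto simp: L_def)
  ultimately have "L = {}" using assms[of L] unfolding send_burst_def by blast
  then have "\<forall>p\<in>set (states F). \<exists>n. \<not> long p n" by (auto simp: L_def)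
  from bchoice[OF this] obtain N where N: "\<And>p. p \<in> set (states F) \<Longrightarrow> \<not> long p (N p)" by blast
  define B where "B = Max (N ` set (states F))"
  have "length w \<le> B" if w: "path F p w q" "\<forall>e \<in> set w. fst e = True" for p w q
  proof (cases w)
    case (Cons e w')
    then obtain r where "(p, e, r) \<in> set (trans F)" using w(1) path_Cons_iff by blast
    then have p: "p \<in> set (states F)" using trans_states by blast
    then have "N p \<le> B" by (simp add: B_def)
    moreover have "length w < N p" using N[OF p] w unfolding long_def by force
    ultimately show ?thesis by simp
  qed simp
  then show ?thesis unfolding runs_bounded_def by blast
qed

section \<open>Dual loops of an affine pair\<close>

text \<open>One inclusion between the two sets \<open>Zset\<close>, stated by signs instead of
  alphabets: what one loop sends the other receives, and conversely.\<close>

definition dual_loops :: "fsm \<Rightarrow> fsm \<Rightarrow> bool" where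
  "dual_loops F G \<longleftrightarrow> (\<forall>w. path F (init F) w (init F) \<longrightarrow>
     (\<exists>w'. path G (init G) w' (init G) \<and> rcv w' = snt w \<and> snt w' = rcv w))"

text \<open>As the alphabets are disjoint, a message determines its channel and hence its sign in
  \<open>F\<close>, so projecting to an alphabet is the same as selecting a sign.\<close>

lemma proj_path:
  assumes "path F p w q" "wf_fsm Out In F" "set Out \<inter> set In = {}"
  shows "proj Out w = snt w \<and> proj In w = rcv w"
  using assms(1)
proof (induction rule: path.induct)
  case (path_cons p e r w q)
  obtain s b where e: "e = (s, b)" by (cases e)
  have "(s \<longrightarrow> b \<in> set Out) \<and> (\<not> s \<longrightarrow> b \<in> set In)"
    using path_cons(1) assms(2) unfolding wf_fsm_def e by fastforce
  then show ?case using path_cons(3) assms(3) unfolding e proj_def by auto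
qed (simp add: proj_def)

text \<open>The output channel of each machine is the input channel of the other. The same
  projections therefore give \<open>(snt w, rcv w)\<close> for the first machine and
  \<open>(rcv w, snt w)\<close> for the second.\<close>

lemma affine_dual_loops:
  assumes "is_SR_pair P" "affine P"
  shows "dual_loops (mach0 P) (mach1 P)" "dual_loops (mach1 P) (mach0 P)"
proof -
  have wf: "wf_fsm (Malpha P) (Mbeta P) (mach0 P)" "wf_fsm (Mbeta P) (Malpha P) (mach1 P)"
    and dis: "set (Malpha P) \<inter> set (Mbeta P) = {}" "set (Mbeta P) \<inter> set (Malpha P) = {}"
    using assms(1) unfolding is_SR_pair_def is_SR_machine_def by auto
  note pr = proj_path[OF _ wf(1) dis(1)] proj_path[OF _ wf(2) dis(2)]
  have Z0: "Zset P (mach0 P) = {(snt w, rcv w) | w. path (mach0 P) (init (mach0 P)) w (init (mach0 P))}"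
    unfolding Zset_def by (intro Collect_cong ex_cong1) (auto dest: pr(1))
  have Z1: "Zset P (mach1 P) = {(rcv w, snt w) | w. path (mach1 P) (init (mach1 P)) w (init (mach1 P))}"
    unfolding Zset_def by (intro Collect_cong ex_cong1) (auto dest: pr(2))
  have eq: "Zset P (mach0 P) = Zset P (mach1 P)" using assms(2) by (simp add: affine_def)
  show "dual_loops (mach0 P) (mach1 P)" unfolding dual_loops_def
  proof (intro allI impI)
    fix w assume "path (mach0 P) (init (mach0 P)) w (init (mach0 P))"
    then have "(snt w, rcv w) \<in> Zset P (mach1 P)" unfolding eq[symmetric] Z0 by blast
    then show "\<exists>w'. path (mach1 P) (init (mach1 P)) w' (init (mach1 P)) \<and> rcv w' = snt w \<and> snt w' = rcv w"
      unfolding Z1 by auto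
  qed
  show "dual_loops (mach1 P) (mach0 P)" unfolding dual_loops_def
  proof (intro allI impI)
    fix w assume "path (mach1 P) (init (mach1 P)) w (init (mach1 P))"
    then have "(rcv w, snt w) \<in> Zset P (mach0 P)" unfolding eq Z1 by blast
    then show "\<exists>w'. path (mach0 P) (init (mach0 P)) w' (init (mach0 P)) \<and> rcv w' = snt w \<and> snt w' = rcv w"
      unfolding Z0 by auto
  qed
qed

text \<open>Short paths \<open>u\<close> and \<open>v\<close> complete a receive run
  \<open>w\<close> of \<open>F\<close> to a loop that sends at most \<open>2 * C\<close> messages.
  The dual loop of \<open>G\<close> receives only these, so bounded send runs keep it short; yet it
  sends everything that \<open>w\<close> receives.\<close>

lemma receive_runs_bounded:
  assumes "sr_fsm F" "dual_loops F G" "runs_bounded True G B"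
  shows "\<exists>B'. runs_bounded False F B'"
proof -
  interpret sr_fsm F by fact
  obtain C where C: "\<And>p q. p \<in> set (states F) \<Longrightarrow> q \<in> set (states F) \<Longrightarrow> \<exists>w. path F p w q \<and> length w \<le> C"
    using connected_bounded by blast
  have "length w \<le> Suc (2 * C) * Suc B"
    if w: "path F p w q" and r: "\<forall>e \<in> set w. fst e = False" for p w q
  proof (cases "w = []")
    case False
    then obtain e w' where "w = e # w'" by (cases w) auto
    then obtain r where "(p, e, r) \<in> set (trans F)" using w path_Cons_iff by blast
    then have p: "p \<in> set (states F)" using trans_states by blast
    obtain u where u: "path F (init F) u p" "length u \<le> C" using C init_state p by blast
    obtain v where v: "path F q v (init F)" "length v \<le> C"
      using C init_state path_state[OF w p] by blast
    have "path F (init F) (u @ w @ v) (init F)" using u v w by (auto simp: path_append_iff)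
    then obtain w' where w': "path G (init G) w' (init G)"
      "rcv w' = snt (u @ w @ v)" "snt w' = rcv (u @ w @ v)"
      using assms(2) unfolding dual_loops_def by blast
    have "snt w = []" using r by (induction w) auto
    then have "length (rcv w') \<le> 2 * C"
      using w'(2) u v length_snt_rcv[of u] length_snt_rcv[of v] by simp
    then have "Suc (length (rcv w')) * Suc B \<le> Suc (2 * C) * Suc B" by (intro mult_le_mono) auto
    then have "length w' \<le> Suc (2 * C) * Suc B"
      using length_le_received[OF assms(3) w'(1)] by linarith
    moreover have "length w = length (rcv w)" using \<open>snt w = []\<close> length_snt_rcv[of w] by simp
    moreover have "length (rcv w) \<le> length w'" using w'(3) length_snt_rcv[of w'] by simp
    ultimately show ?thesis by simp
  qed simp
  then show ?thesis unfolding runs_bounded_def by blast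
qed

section \<open>Reachable global states of affine pairs\<close>

text \<open>Invariant of all steps: a channel holds what its sender has sent beyond what its
  receiver has consumed.\<close>

lemma reachable_paths:
  assumes "reachable P ((p0, p1), (xa, xb))"
  shows "\<exists>u0 u1. path (mach0 P) (init (mach0 P)) u0 p0 \<and> path (mach1 P) (init (mach1 P)) u1 p1 \<and>
    snt u0 = rcv u1 @ xa \<and> snt u1 = rcv u0 @ xb"
proof -
  let ?I = "\<lambda>c. \<exists>u0 u1. path (mach0 P) (init (mach0 P)) u0 (fst (fst c)) \<and>
    path (mach1 P) (init (mach1 P)) u1 (snd (fst c)) \<and>
    snt u0 = rcv u1 @ fst (snd c) \<and> snt u1 = rcv u0 @ snd (snd c)"
  have "(gstep P)\<^sup>*\<^sup>* (initial_gstate P) c \<Longrightarrow> ?I c" for c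
  proof (induction rule: rtranclp_induct)
    case base
    show ?case by (intro exI[of _ "[]"]) (simp add: initial_gstate_def)
  next
    case (step c d)
    then obtain u0 u1 where u: "path (mach0 P) (init (mach0 P)) u0 (fst (fst c))"
      "path (mach1 P) (init (mach1 P)) u1 (snd (fst c))"
      "snt u0 = rcv u1 @ fst (snd c)" "snt u1 = rcv u0 @ snd (snd c)" by blast
    from step(2) show ?case
    proof cases
      case (send0 p0 b q p1 xa xb)
      then show ?thesis using u path_snoc
        by (intro exI[of _ "u0 @ [(True, b)]"] exI[of _ u1]) fastforce
    next
      case (recv0 p0 b q p1 xa xb)
      then show ?thesis using u path_snoc
        by (intro exI[of _ "u0 @ [(False, b)]"] exI[of _ u1]) fastforce
    next
      case (send1 p1 b q p0 xa xb)
      then show ?thesis using u path_snoc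
        by (intro exI[of _ u0] exI[of _ "u1 @ [(True, b)]"]) fastforce
    next
      case (recv1 p1 b q p0 xa xb)
      then show ?thesis using u path_snoc
        by (intro exI[of _ u0] exI[of _ "u1 @ [(False, b)]"]) fastforce
    qed
  qed
  from this[OF assms[unfolded reachable_def]] show ?thesis by simp
qed

lemma longest_common_prefix_split:
  "\<exists>w r r'. u = w @ r \<and> u' = w @ r' \<and> (r = [] \<or> r' = [] \<or> hd r \<noteq> hd r')"
proof (induction u arbitrary: u')
  case (Cons e u)
  show ?case
  proof (cases "\<exists>v. u' = e # v")
    case True
    then obtain v where v: "u' = e # v" by blast
    from Cons[of v] obtain w r r' where "u = w @ r" "v = w @ r'" "r = [] \<or> r' = [] \<or> hd r \<noteq> hd r'"
      by blast
    then show ?thesis using v by (intro exI[of _ "e # w"] exI[of _ r] exI[of _ r']) auto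
  next
    case False
    then show ?thesis by (intro exI[of _ "[]"] exI[of _ "e # u"] exI[of _ u']) (cases u'; auto)
  qed
qed auto

text \<open>Close the path of the first machine by a short detour to its initial state. The loop of the
  second machine dual to it and the actual path of the second machine can only part after the latter
  has sent everything the first machine received, so the undelivered messages lie in parts with few
  events of one polarity.\<close>
lemma bounded_channels_if_runs_bounded:
  assumes "sr_fsm (mach0 P)" "sr_fsm (mach1 P)" "dual_loops (mach0 P) (mach1 P)"
    and sb: "runs_bounded True (mach1 P) B" and rb: "runs_bounded False (mach1 P) B'"
  shows "bounded_channels P"
proof -
  interpret F0: sr_fsm "mach0 P" by fact
  interpret F1: sr_fsm "mach1 P" by fact
  obtain C where C: "\<And>p q. p \<in> set (states (mach0 P)) \<Longrightarrow> q \<in> set (states (mach0 P)) \<Longrightarrow>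
      \<exists>w. path (mach0 P) p w q \<and> length w \<le> C"
    using F0.connected_bounded by blast
  \<comment> \<open>\<open>D\<close> will bound the rest \<open>r'\<close> of the dual loop, in
    which at most \<open>C\<close> messages are sent; \<open>E\<close> will bound the rest
    \<open>r\<close> of the actual path, in which at most \<open>D\<close> messages are
    received.\<close>
  define D where "D = Suc C * Suc B'"
  define E where "E = Suc D * Suc B"
  have "length x + length y \<le> D + (C + E)" if reach: "reachable P ((p0, p1), (x, y))" for p0 p1 x y
  proof -
    obtain u0 u1 where u: "path (mach0 P) (init (mach0 P)) u0 p0"
      "path (mach1 P) (init (mach1 P)) u1 p1" "snt u0 = rcv u1 @ x" "snt u1 = rcv u0 @ y"
      using reachable_paths[OF reach] by blast
    obtain v where v: "path (mach0 P) p0 v (init (mach0 P))" "length v \<le> C"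
      using C F0.init_state F0.path_state[OF u(1)] by blast
    have "path (mach0 P) (init (mach0 P)) (u0 @ v) (init (mach0 P))"
      using u v by (auto simp: path_append_iff)
    then obtain u1' where u1': "path (mach1 P) (init (mach1 P)) u1' (init (mach1 P))"
      "rcv u1' = snt (u0 @ v)" "snt u1' = rcv (u0 @ v)"
      using assms(3) unfolding dual_loops_def by blast
    obtain w r r' where w: "u1 = w @ r" "u1' = w @ r'" and hd: "r = [] \<or> r' = [] \<or> hd r \<noteq> hd r'"
      using longest_common_prefix_split by blast
    obtain s where s: "path (mach1 P) s r p1" "path (mach1 P) (init (mach1 P)) w s"
      using u(2) w by (auto simp: path_append_iff)
    have s': "path (mach1 P) s r' (init (mach1 P))"
      using u1'(1) s(2) F1.path_deterministic unfolding w path_append_iff by blast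
    have rw': "rcv w @ rcv r' = rcv w @ rcv r @ x @ snt v" using u1' w u by simp
    have sw: "snt w @ snt r = rcv u0 @ y" using u w by simp
    have sw': "snt w @ snt r' = rcv u0 @ rcv v" using u1' w by simp
    have len: "length (snt v) + length (rcv v) \<le> C" using v length_snt_rcv[of v] by simp
    \<comment> \<open>If one rest is empty, \<open>w\<close> already sends all of
      \<open>rcv u0\<close>. Otherwise the two rests start with different events at the same state
      \<open>s\<close>, which by \<open>polarity\<close> differ only in the message.\<close>
    have key: "length (rcv u0) \<le> length (snt w)"
    proof (cases "r = [] \<or> r' = []")
      case True
      then show ?thesis using arg_cong[OF sw, of length] arg_cong[OF sw', of length] by auto
    next
      case False
      then obtain e z e' z' where e: "r = e # z" "r' = e' # z'" "e \<noteq> e'"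
        using hd by (cases r; cases r') auto
      have pol: "fst e = fst e'" using s(1) s' F1.polarity unfolding e path_Cons_iff by blast
      then have neq: "snd e \<noteq> snd e'" using e(3) by (simp add: prod_eq_iff)
      show ?thesis
      proof (cases "fst e")
        \<comment> \<open>By \<open>rw'\<close>, the word \<open>rcv r'\<close> extends
          \<open>rcv r\<close>, so two initial receptions would carry the same message.\<close>
        case False
        then show ?thesis using rw' neq pol by (simp add: e)
      next
        case True
        show ?thesis
        proof (rule ccontr)
          assume less: "\<not> ?thesis"
          \<comment> \<open>Both rests send their first message into position \<open>?n\<close> of a
            word beginning with \<open>rcv u0\<close>; if \<open>?n\<close> lies within
            \<open>rcv u0\<close>, the two messages agree.\<close>
          let ?n = "length (snt w)"
          have "snd e = (snt w @ snt r) ! ?n" using True by (simp add: e)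
          also have "\<dots> = rcv u0 ! ?n" using less by (simp add: sw nth_append)
          also have "\<dots> = (snt w @ snt r') ! ?n" using less by (simp add: sw' nth_append)
          also have "\<dots> = snd e'" using True pol by (simp add: e)
          finally show False using neq by simp
        qed
      qed
    qed
    \<comment> \<open>By \<open>key\<close>, whatever the dual loop sends after \<open>w\<close>
      lies within \<open>rcv v\<close>.\<close>
    have "length (snt r') \<le> C" using arg_cong[OF sw', of length] key len by simp
    then have "Suc (length (snt r')) * Suc B' \<le> D" unfolding D_def by (intro mult_le_mono) auto
    then have D: "length r' \<le> D" using length_le_sent[OF rb s'] by linarith
    then have x: "length (rcv r) + length x \<le> D" using rw' length_snt_rcv[of r'] by simp
    then have "Suc (length (rcv r)) * Suc B \<le> E" unfolding E_def by (intro mult_le_mono) auto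
    then have "length r \<le> E" using length_le_received[OF sb s(1)] by linarith
    then have "length (snt r) \<le> E" using length_snt_rcv[of r] by simp
    moreover have "length (snt w) \<le> length (rcv u0) + C" using arg_cong[OF sw', of length] len by simp
    ultimately have "length y \<le> C + E" using arg_cong[OF sw, of length] by simp
    then show ?thesis using x by simp
  qed
  then have "length (fst (snd c)) + length (snd (snd c)) \<le> D + (C + E)" if "reachable P c" for c
    using that by (cases c) (auto simp: split_paired_all)
  then show ?thesis unfolding bounded_channels_def by blast
qed

text \<open>Here \<open>a0\<close> and \<open>a1\<close> have been executed already; as the words of the two loops match, executing
  the rest greedily can only get stuck in a deadlock.\<close>
lemma deadlock_free_schedule:
  assumes "sr_fsm (mach0 P)" "sr_fsm (mach1 P)" "deadlock_free P"
    and v0: "path (mach0 P) (init (mach0 P)) (a0 @ r0) p0"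
    and u1: "path (mach1 P) (init (mach1 P)) (a1 @ r1) p1"
    and match: "snt (a0 @ r0 @ z0) = rcv (a1 @ r1)" "rcv (a0 @ r0 @ z0) = snt (a1 @ r1)"
    and "path (mach0 P) (init (mach0 P)) a0 q0" "path (mach1 P) (init (mach1 P)) a1 q1"
    and "snt a0 = rcv a1 @ xa" "snt a1 = rcv a0 @ xb"
    and "reachable P ((q0, q1), (xa, xb))"
  shows "\<exists>p1 xa xb. reachable P ((p0, p1), (xa, xb))"
  using assms(4-)
proof (induction "length r0 + length r1" arbitrary: a0 r0 a1 r1 q0 q1 xa xb rule: less_induct)
  case less
  interpret F0: sr_fsm "mach0 P" by fact
  interpret F1: sr_fsm "mach1 P" by fact
  note prems = less(2-)
  note reach = prems(9)
  have ext: "reachable P d" if "gstep P ((q0, q1), (xa, xb)) d" for d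
    using reach that unfolding reachable_def by (rule rtranclp.rtrancl_into_rtrancl)
  have p: "path (mach0 P) q0 r0 p0" "path (mach1 P) q1 r1 p1"
    using prems(1,2,5,6) F0.path_deterministic F1.path_deterministic
    unfolding path_append_iff by blast+
  \<comment> \<open>One event of the first machine passes from \<open>r0\<close> to
    \<open>a0\<close>. The concatenation and hence the matching words stay the same, while fewer
    events remain; \<open>ya\<close> and \<open>yb\<close> are the channels afterwards.\<close>
  have move0: ?case
    if "r0 = e # r" "(q0, e, q) \<in> set (trans (mach0 P))" "path (mach0 P) q r p0"
      "gstep P ((q0, q1), (xa, xb)) ((q, q1), (ya, yb))"
      "snt (a0 @ [e]) = rcv a1 @ ya" "snt a1 = rcv (a0 @ [e]) @ yb" for e r q ya yb
    by (rule less.hyps[of r r1 "a0 @ [e]" a1 q q1 ya yb])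
      (use that prems ext path_snoc in auto)
  have move1: ?case
    if "r1 = e # r" "(q1, e, q) \<in> set (trans (mach1 P))" "path (mach1 P) q r p1"
      "gstep P ((q0, q1), (xa, xb)) ((q0, q), (ya, yb))"
      "snt a0 = rcv (a1 @ [e]) @ ya" "snt (a1 @ [e]) = rcv a0 @ yb" for e r q ya yb
    by (rule less.hyps[of r0 r a0 "a1 @ [e]" q0 q ya yb])
      (use that prems ext path_snoc in auto)
  show ?case
  proof (cases r0)
    case Nil
    then have "q0 = p0" using p by simp
    then show ?thesis using reach by blast
  next
    case (Cons e0 r0')
    obtain s0 b0 where e0: "e0 = (s0, b0)" by (cases e0)
    obtain t0 where t0: "(q0, e0, t0) \<in> set (trans (mach0 P))" "path (mach0 P) t0 r0' p0"
      using p Cons by (auto simp: path_Cons_iff)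
    show ?thesis
    proof (cases s0)
      case True
      show ?thesis
        by (rule move0[OF Cons t0, of "xa @ [b0]" xb])
          (use t0 prems e0 True gstep.send0 in auto)
    next
      case s0: False
      show ?thesis
      proof (cases xb)
        case xb: (Cons m xb')
        \<comment> \<open>The first machine receives, in order, what the second sends, and
          \<open>rcv a0\<close> is consumed already; the next message due is the front of
          \<open>xb\<close>.\<close>
        have "b0 = m" using prems(4,8) by (simp add: Cons e0 s0 xb)
        then show ?thesis
          by (intro move0[OF Cons t0, of xa xb'])
            (use t0 prems e0 s0 xb gstep.recv0 in auto)
      next
        case xb: Nil
        show ?thesis
        proof (cases r1)
          case Nil
          \<comment> \<open>Impossible: the second machine has sent everything and all of it is
            consumed, yet the first machine still has to receive \<open>b0\<close>.\<close>
          then show ?thesis using prems(4,8) by (simp add: Cons e0 s0 xb)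
        next
          case r1: (Cons e1 r1')
          obtain s1 b1 where e1: "e1 = (s1, b1)" by (cases e1)
          obtain t1 where t1: "(q1, e1, t1) \<in> set (trans (mach1 P))" "path (mach1 P) t1 r1' p1"
            using p r1 by (auto simp: path_Cons_iff)
          show ?thesis
          proof (cases s1)
            case True
            show ?thesis
              by (rule move1[OF r1 t1, of xa "xb @ [b1]"])
                (use t1 prems e1 True gstep.send1 in auto)
          next
            case s1: False
            show ?thesis
            proof (cases xa)
              case xa: (Cons m xa')
              have "b1 = m" using prems(3,7) by (simp add: r1 e1 s1 xa)
              then show ?thesis
                by (intro move1[OF r1 t1, of xa' xb])
                  (use t1 prems e1 s1 xa gstep.recv1 in auto)
            next
              case xa: Nil
              have "deadlocked P ((q0, q1), (xa, xb))"
                unfolding deadlocked_def receive_state_def xa xb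
                using F0.polarity[OF t0(1)] F1.polarity[OF t1(1)] by (fastforce simp: e0 e1 s0 s1)
              then show ?thesis using assms(3) reach by (simp add: deadlock_free_def)
            qed
          qed
        qed
      qed
    qed
  qed
qed

section \<open>Unbounded channels from send cycles\<close>

text \<open>Put \<open>p\<close> on a loop made of \<open>u\<close> and \<open>v\<close> and
  schedule \<open>u\<close> against the dual of the whole loop; \<open>v\<close> plays the role of
  the unexecuted part \<open>z0\<close>.\<close>

lemma deadlock_free_reaches_state0:
  assumes "sr_fsm (mach0 P)" "sr_fsm (mach1 P)" "dual_loops (mach0 P) (mach1 P)" "deadlock_free P"
    and p: "p \<in> set (states (mach0 P))"
  shows "\<exists>p1 xa xb. reachable P ((p, p1), (xa, xb))"
proof -
  interpret F0: sr_fsm "mach0 P" by fact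
  obtain u v where u: "path (mach0 P) (init (mach0 P)) u p" "path (mach0 P) p v (init (mach0 P))"
    using F0.connected F0.init_state p by blast
  then have "path (mach0 P) (init (mach0 P)) (u @ v) (init (mach0 P))"
    by (auto simp: path_append_iff)
  then obtain w where w: "path (mach1 P) (init (mach1 P)) w (init (mach1 P))"
      "rcv w = snt (u @ v)" "snt w = rcv (u @ v)"
    using assms(3) unfolding dual_loops_def by blast
  show ?thesis
    by (rule deadlock_free_schedule[OF assms(1,2,4), of "[]" u _ "[]" w "init (mach1 P)" v
          "init (mach0 P)" "init (mach1 P)" "[]" "[]"])
      (use u w in \<open>auto simp: reachable_def initial_gstate_def\<close>)
qed

lemma send_path_reachable0:
  assumes "path (mach0 P) p w q" "\<forall>e \<in> set w. fst e" "reachable P ((p, p1), (xa, xb))"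
  shows "reachable P ((q, p1), (xa @ map snd w, xb))"
  using assms
proof (induction arbitrary: xa rule: path.induct)
  case (path_cons p e r w q)
  obtain b where e: "e = (True, b)" using path_cons(4) by (cases e) auto
  have "gstep P ((p, p1), (xa, xb)) ((r, p1), (xa @ [b], xb))"
    using path_cons(1) e gstep.send0 by blast
  then have "reachable P ((r, p1), (xa @ [b], xb))"
    using path_cons(5) unfolding reachable_def by (meson rtranclp.rtrancl_into_rtrancl)
  then show ?case using path_cons(3)[of "xa @ [b]"] path_cons(4) e by simp
qed simp

text \<open>Some reachable global state has the first machine inside the burst. From there it sends
  \<open>Suc N\<close> messages without waiting for the other machine, which refutes any bound
  \<open>N\<close>.\<close>

lemma send_burst0_unbounded:
  assumes "sr_fsm (mach0 P)" "sr_fsm (mach1 P)" "dual_loops (mach0 P) (mach1 P)" "deadlock_free P"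
    and L: "send_burst (mach0 P) L"
  shows "\<not> bounded_channels P"
proof
  interpret F0: sr_fsm "mach0 P" by fact
  assume "bounded_channels P"
  then obtain N where N: "\<And>c. reachable P c \<Longrightarrow> length (fst (snd c)) + length (snd (snd c)) \<le> N"
    unfolding bounded_channels_def by blast
  obtain p where p: "p \<in> L" using L by (auto simp: send_burst_def)
  then have "p \<in> set (states (mach0 P))" using L F0.trans_states unfolding send_burst_def by blast
  then obtain p1 xa xb where r: "reachable P ((p, p1), (xa, xb))"
    using deadlock_free_reaches_state0[OF assms(1-4)] by blast
  obtain w q where w: "path (mach0 P) p w q" "\<forall>e \<in> set w. fst e" "length w = Suc N"
    using send_burst_path[OF L p] by blast
  show False using N[OF send_path_reachable0[OF w(1,2) r]] w(3) by simp
qed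

section \<open>Symmetry under exchange of the two machines\<close>

definition swap_pair :: "sr_pair \<Rightarrow> sr_pair" where
  "swap_pair P = SRPair (Mbeta P) (Malpha P) (mach1 P) (mach0 P)"

definition swap_gstate :: "gstate \<Rightarrow> gstate" where
  "swap_gstate c = (prod.swap (fst c), prod.swap (snd c))"

lemma swap_simps [simp]:
  "mach0 (swap_pair P) = mach1 P" "mach1 (swap_pair P) = mach0 P" "swap_pair (swap_pair P) = P"
  "swap_gstate (swap_gstate c) = c" "swap_gstate ((p, q), (x, y)) = ((q, p), (y, x))"
  "fst (fst (swap_gstate c)) = snd (fst c)" "snd (fst (swap_gstate c)) = fst (fst c)"
  "fst (snd (swap_gstate c)) = snd (snd c)" "snd (snd (swap_gstate c)) = fst (snd c)"
  by (auto simp: swap_pair_def swap_gstate_def)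

lemma reachable_swap_imp:
  assumes "reachable P c"
  shows "reachable (swap_pair P) (swap_gstate c)"
proof -
  have swap: "gstep (swap_pair P) (swap_gstate c) (swap_gstate d)" if "gstep P c d" for c d
    using that by cases (auto intro: gstep.intros)
  have "(gstep P)\<^sup>*\<^sup>* (initial_gstate P) c \<Longrightarrow>
      (gstep (swap_pair P))\<^sup>*\<^sup>* (initial_gstate (swap_pair P)) (swap_gstate c)" for c
  proof (induction rule: rtranclp_induct)
    case base
    show ?case by (simp add: initial_gstate_def)
  next
    case (step y z)
    then show ?case by (meson swap rtranclp.rtrancl_into_rtrancl)
  qed
  then show ?thesis using assms by (simp add: reachable_def)
qed

lemma deadlock_free_swap: "deadlock_free P \<Longrightarrow> deadlock_free (swap_pair P)"
  unfolding deadlock_free_def deadlocked_def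
  using reachable_swap_imp[of "swap_pair P"] by (metis swap_simps)

lemma bounded_channels_swap: "bounded_channels P \<Longrightarrow> bounded_channels (swap_pair P)"
  unfolding bounded_channels_def
  using reachable_swap_imp[of "swap_pair P"] by (metis swap_simps add.commute)

lemma send_burst1_unbounded:
  assumes "sr_fsm (mach0 P)" "sr_fsm (mach1 P)" "dual_loops (mach1 P) (mach0 P)" "deadlock_free P"
    and L: "send_burst (mach1 P) L"
  shows "\<not> bounded_channels P"
  using send_burst0_unbounded[of "swap_pair P"] assms deadlock_free_swap bounded_channels_swap
  by (metis swap_simps(1,2))

text \<open>Replaces unboundedness, which has no single finite witness, by a send burst, which has
  one. The replacement is exact only together with the alternative of a deadlock, since
  deadlock-freedom is what makes a burst reachable.\<close>

lemma not_deadlock_free_bounded_iff: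
  assumes "is_SR_pair P" "affine P"
  shows "\<not> (deadlock_free P \<and> bounded_channels P) \<longleftrightarrow> \<not> deadlock_free P \<or>
    (\<exists>L \<subseteq> set (states (mach0 P)). send_burst (mach0 P) L) \<or>
    (\<exists>L \<subseteq> set (states (mach1 P)). send_burst (mach1 P) L)"
proof -
  have sr: "sr_fsm (mach0 P)" "sr_fsm (mach1 P)"
    using assms(1) SR_machine_sr_fsm unfolding is_SR_pair_def by blast+
  note dual = affine_dual_loops[OF assms]
  have "bounded_channels P"
    if nb: "\<not> (\<exists>L \<subseteq> set (states (mach0 P)). send_burst (mach0 P) L)"
      "\<not> (\<exists>L \<subseteq> set (states (mach1 P)). send_burst (mach1 P) L)"
  proof -
    obtain B0 where B0: "runs_bounded True (mach0 P) B0"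
      using sr_fsm.no_send_burst_runs_bounded[OF sr(1)] nb by blast
    obtain B1 where B1: "runs_bounded True (mach1 P) B1"
      using sr_fsm.no_send_burst_runs_bounded[OF sr(2)] nb by blast
    \<comment> \<open>Duality transfers the send bound of the first machine into a receive bound of
      the second.\<close>
    obtain B2 where B2: "runs_bounded False (mach1 P) B2"
      using receive_runs_bounded[OF sr(2) dual(2) B0] by blast
    show ?thesis by (rule bounded_channels_if_runs_bounded[OF sr dual(1) B1 B2])
  qed
  then show ?thesis
    using send_burst0_unbounded[OF sr dual(1)] send_burst1_unbounded[OF sr dual(2)] by blast
qed

section \<open>Computable functions on codes\<close>

text \<open>Total functions of arity \<open>k\<close>; lists of other lengths are
  unconstrained.\<close>

definition computable :: "nat \<Rightarrow> (nat list \<Rightarrow> nat) \<Rightarrow> bool" where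
  "computable k f \<longleftrightarrow> (\<exists>r. \<forall>xs. length xs = k \<longrightarrow> reval r xs (f xs))"

lemma computable_nth: "i < k \<Longrightarrow> computable k (\<lambda>xs. xs ! i)"
  unfolding computable_def using reval_Proj by blast

lemma computable_comp:
  assumes "computable (length gs) f" "\<forall>g \<in> set gs. computable k g"
  shows "computable k (\<lambda>xs. f (map (\<lambda>g. g xs) gs))"
proof -
  obtain rf where rf: "\<And>ys. length ys = length gs \<Longrightarrow> reval rf ys (f ys)"
    using assms(1) unfolding computable_def by blast
  from assms(2)[unfolded computable_def] have
    "\<forall>g \<in> set gs. \<exists>r. \<forall>xs. length xs = k \<longrightarrow> reval r xs (g xs)" .
  from bchoice[OF this] obtain R where
    R: "\<And>g xs. g \<in> set gs \<Longrightarrow> length xs = k \<Longrightarrow> reval (R g) xs (g xs)" by blast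
  have "reval (Comp rf (map R gs)) xs (f (map (\<lambda>g. g xs) gs))" if "length xs = k" for xs
    by (rule reval_Comp[where ys = "map (\<lambda>g. g xs) gs"]) (use that R rf in auto)
  then show ?thesis unfolding computable_def by blast
qed

lemma computable_comp1:
  assumes "computable 1 (\<lambda>ys. f (ys ! 0))" "computable k g"
  shows "computable k (\<lambda>xs. f (g xs))"
  using computable_comp[of "[g]" "\<lambda>ys. f (ys ! 0)" k] assms by simp

lemma computable_comp2:
  assumes "computable 2 (\<lambda>ys. f (ys ! 0) (ys ! 1))" "computable k g" "computable k h"
  shows "computable k (\<lambda>xs. f (g xs) (h xs))"
  using computable_comp[of "[g, h]" "\<lambda>ys. f (ys ! 0) (ys ! 1)" k] assms by (simp add: numeral_2_eq_2)

lemma computable_Suc: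
  assumes "computable k f"
  shows "computable k (\<lambda>xs. Suc (f xs))"
proof -
  have "reval Succ xs (Suc (xs ! 0))" if "length xs = 1" for xs
    using that reval_Succ by (cases xs) auto
  then have "computable 1 (\<lambda>ys. Suc (ys ! 0))" unfolding computable_def by blast
  from computable_comp1[where f = "Suc", OF this assms] show ?thesis .
qed

lemma computable_const: "computable k (\<lambda>xs. c)"
proof (induction c)
  case 0
  show ?case unfolding computable_def using reval_Zero by blast
qed (rule computable_Suc)

lemma computable_rec_nat:
  assumes "computable k a" "computable (Suc (Suc k)) b" "computable k m"
  shows "computable k (\<lambda>xs. rec_nat (a xs) (\<lambda>n y. b (y # n # xs)) (m xs))"
proof -
  obtain ra where ra: "\<And>xs. length xs = k \<Longrightarrow> reval ra xs (a xs)"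
    using assms(1) unfolding computable_def by blast
  obtain rb where rb: "\<And>xs. length xs = Suc (Suc k) \<Longrightarrow> reval rb xs (b xs)"
    using assms(2) unfolding computable_def by blast
  have "reval (Prim ra rb) (n # xs) (rec_nat (a xs) (\<lambda>n y. b (y # n # xs)) n)"
    if "length xs = k" for n xs
    by (induction n) (use that ra rb in \<open>auto intro: reval_Prim0 reval_PrimS\<close>)
  then have "reval (Prim ra rb) ys (rec_nat (a (tl ys)) (\<lambda>n y. b (y # n # tl ys)) (hd ys))"
    if "length ys = Suc k" for ys using that by (cases ys) auto
  then have P: "computable (Suc k) (\<lambda>ys. rec_nat (a (tl ys)) (\<lambda>n y. b (y # n # tl ys)) (hd ys))"
    unfolding computable_def by blast
  \<comment> \<open>\<open>Prim\<close> recurses on its first argument, so it is fed with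
    \<open>m xs\<close> followed by all projections, which rebuild \<open>xs\<close>.\<close>
  let ?gs = "m # map (\<lambda>i xs. xs ! i) [0..<k]"
  have "computable k (\<lambda>xs. (\<lambda>ys. rec_nat (a (tl ys)) (\<lambda>n y. b (y # n # tl ys)) (hd ys)) (map (\<lambda>g. g xs) ?gs))"
    by (rule computable_comp) (use P assms(3) computable_nth in auto)
  then have C: "computable k (\<lambda>xs. rec_nat (a (map ((!) xs) [0..<k]))
      (\<lambda>n y. b (y # n # map ((!) xs) [0..<k])) (m xs))" by (simp add: comp_def)
  have nth: "map ((!) xs) [0..<k] = xs" if "length xs = k" for xs :: "nat list"
    using map_nth[of xs] that by simp
  show ?thesis using C unfolding computable_def by (simp add: nth cong: conj_cong imp_cong)
qed

lemma computable_add: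
  assumes "computable k f" "computable k g"
  shows "computable k (\<lambda>xs. f xs + g xs)"
proof -
  have "computable 2 (\<lambda>xs. rec_nat (xs ! 1) (\<lambda>n y. (\<lambda>ys. Suc (ys ! 0)) (y # n # xs)) (xs ! 0))"
    by (rule computable_rec_nat) (auto intro!: computable_nth computable_Suc)
  moreover have "rec_nat v (\<lambda>n. Suc) u = u + v" for u v :: nat by (induction u) auto
  ultimately have "computable 2 (\<lambda>xs. xs ! 0 + xs ! 1)" by simp
  from computable_comp2[where f = "(+)", OF this assms] show ?thesis .
qed

lemma computable_pred:
  assumes "computable k f"
  shows "computable k (\<lambda>xs. f xs - 1)"
proof -
  have "computable 1 (\<lambda>xs. rec_nat 0 (\<lambda>n y. (\<lambda>ys. ys ! 1) (y # n # xs)) (xs ! 0))"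
    by (rule computable_rec_nat) (auto intro!: computable_nth computable_const)
  moreover have "rec_nat 0 (\<lambda>n y. n) u = u - 1" for u :: nat by (cases u) auto
  ultimately have "computable 1 (\<lambda>xs. xs ! 0 - 1)" by simp
  from computable_comp1[where f = "\<lambda>u. u - 1", OF this assms] show ?thesis .
qed

lemma computable_diff:
  assumes "computable k f" "computable k g"
  shows "computable k (\<lambda>xs. f xs - g xs)"
proof -
  have "computable 2 (\<lambda>xs. rec_nat (xs ! 0) (\<lambda>n y. (\<lambda>ys. ys ! 0 - 1) (y # n # xs)) (xs ! 1))"
    by (rule computable_rec_nat) (auto intro!: computable_nth computable_pred[unfolded One_nat_def])
  moreover have "rec_nat u (\<lambda>n y. y - Suc 0) v = u - v" for u v :: nat by (induction v) auto
  ultimately have "computable 2 (\<lambda>xs. xs ! 0 - xs ! 1)" by simp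
  from computable_comp2[where f = "(-)", OF this assms] show ?thesis .
qed

lemma computable_triangle:
  assumes "computable k f"
  shows "computable k (\<lambda>xs. triangle (f xs))"
proof -
  have "computable 1 (\<lambda>xs. rec_nat 0 (\<lambda>n y. (\<lambda>ys. ys ! 0 + Suc (ys ! 1)) (y # n # xs)) (xs ! 0))"
    by (rule computable_rec_nat)
      (auto intro!: computable_nth computable_const computable_add computable_Suc)
  moreover have "rec_nat 0 (\<lambda>n y. Suc (y + n)) u = triangle u" for u :: nat by (induction u) auto
  ultimately have "computable 1 (\<lambda>xs. triangle (xs ! 0))" by simp
  from computable_comp1[where f = "triangle", OF this assms] show ?thesis .
qed

text \<open>The value 0 means success, as in \<open>Mu\<close>; the second assumption keeps the
  search total.\<close>

lemma computable_Least:
  assumes "computable (Suc k) f" "\<And>xs. \<exists>n. f (n # xs) = 0"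
  shows "computable k (\<lambda>xs. LEAST n. f (n # xs) = 0)"
proof -
  obtain r where r: "\<And>xs. length xs = Suc k \<Longrightarrow> reval r xs (f xs)"
    using assms(1) unfolding computable_def by blast
  have "reval (Mu r) xs (LEAST n. f (n # xs) = 0)" if len: "length xs = k" for xs
  proof (rule reval_Mu)
    let ?n = "LEAST n. f (n # xs) = 0"
    have "f (?n # xs) = 0" using assms(2) by (rule LeastI_ex)
    then show "reval r (?n # xs) 0" using r[of "?n # xs"] len by simp
    show "\<forall>m<?n. \<exists>k. reval r (m # xs) (Suc k)"
    proof (intro allI impI)
      fix m assume "m < ?n"
      then have "f (m # xs) \<noteq> 0" using not_less_Least by blast
      then obtain j where "f (m # xs) = Suc j" using not0_implies_Suc by blast
      then show "\<exists>k. reval r (m # xs) (Suc k)" using r[of "m # xs"] len by auto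
    qed
  qed
  then show ?thesis unfolding computable_def by blast
qed

section \<open>Computability of the Cantor pairing and its inverses\<close>

abbreviation cpair :: "nat \<Rightarrow> nat \<Rightarrow> nat" where "cpair m n \<equiv> prod_encode (m, n)"
abbreviation cfst :: "nat \<Rightarrow> nat" where "cfst z \<equiv> fst (prod_decode z)"
abbreviation csnd :: "nat \<Rightarrow> nat" where "csnd z \<equiv> snd (prod_decode z)"

lemma computable_cpair:
  "computable k f \<Longrightarrow> computable k g \<Longrightarrow> computable k (\<lambda>xs. cpair (f xs) (g xs))"
  by (simp add: prod_encode_def computable_add computable_triangle)

lemma triangle_mono: "m \<le> n \<Longrightarrow> triangle m \<le> triangle n"
  by (induction rule: dec_induct) auto

text \<open>The sum \<open>m + n\<close> is the index of the diagonal that contains the code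
  \<open>z\<close>, the least \<open>w\<close> with \<open>z < triangle (Suc w)\<close>. Truncated
  subtraction expresses this inequality as an equation with 0.\<close>

lemma triangle_root: "(LEAST w. Suc (cpair m n) - triangle (Suc w) = 0) = m + n"
proof (rule Least_equality)
  show "Suc (cpair m n) - triangle (Suc (m + n)) = 0" by (simp add: prod_encode_def)
  fix w assume w: "Suc (cpair m n) - triangle (Suc w) = 0"
  show "m + n \<le> w"
  proof (rule ccontr)
    assume "\<not> m + n \<le> w"
    then have "triangle (Suc w) \<le> triangle (m + n)" by (intro triangle_mono) simp
    then show False using w by (simp add: prod_encode_def)
  qed
qed

text \<open>Decoding begins with the diagonal, found by minimisation. The first component is then
  the offset of the code from \<open>triangle\<close> of this sum, and the second is what remains of
  the sum.\<close>

lemma computable_csum: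
  assumes "computable k f"
  shows "computable k (\<lambda>xs. cfst (f xs) + csnd (f xs))"
proof -
  have ex: "\<exists>n. Suc z - triangle (Suc n) = 0" for z
    by (rule exI[of _ z]) simp
  have "computable 1 (\<lambda>xs. LEAST n. (\<lambda>ys. Suc (ys ! 1) - triangle (Suc (ys ! 0))) (n # xs) = 0)"
    by (rule computable_Least)
      (use ex in \<open>auto intro!: computable_nth computable_diff computable_Suc computable_triangle
        simp del: triangle_Suc diff_is_0_eq\<close>)
  moreover have "(LEAST n. Suc z - triangle (Suc n) = 0) = cfst z + csnd z" for z
    using triangle_root[of "cfst z" "csnd z"] by simp
  ultimately have "computable 1 (\<lambda>xs. cfst (xs ! 0) + csnd (xs ! 0))"
    by (simp del: triangle_Suc diff_is_0_eq)
  from computable_comp1[where f = "\<lambda>z. cfst z + csnd z", OF this assms] show ?thesis .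
qed

lemma computable_cfst:
  assumes "computable k f"
  shows "computable k (\<lambda>xs. cfst (f xs))"
proof -
  have "computable 1 (\<lambda>xs. xs ! 0 - triangle (cfst (xs ! 0) + csnd (xs ! 0)))"
    by (intro computable_diff computable_triangle computable_csum computable_nth) auto
  moreover have "z - triangle (cfst z + csnd z) = cfst z" for z
    using prod_decode_inverse[of z] by (cases "prod_decode z") (auto simp: prod_encode_def)
  ultimately have "computable 1 (\<lambda>xs. cfst (xs ! 0))" by simp
  from computable_comp1[where f = "\<lambda>z. cfst z", OF this assms] show ?thesis .
qed

lemma computable_csnd: "computable k f \<Longrightarrow> computable k (\<lambda>xs. csnd (f xs))"
  using computable_diff[OF computable_csum computable_cfst, of k f f] by simp

section \<open>Closure rules for unary computable functions and predicates\<close>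

definition comp_fun :: "(nat \<Rightarrow> nat) \<Rightarrow> bool" where
  "comp_fun f \<longleftrightarrow> computable 1 (\<lambda>xs. f (xs ! 0))"

definition comp_pred :: "(nat \<Rightarrow> bool) \<Rightarrow> bool" where
  "comp_pred P \<longleftrightarrow> comp_fun (\<lambda>x. of_bool (P x))"

named_theorems comp_intros

lemma comp_basic [comp_intros]:
  "comp_fun (\<lambda>x. x)" "comp_fun (\<lambda>x. c)"
  "comp_fun f \<Longrightarrow> comp_fun (\<lambda>x. Suc (f x))"
  "comp_fun f \<Longrightarrow> comp_fun g \<Longrightarrow> comp_fun (\<lambda>x. f x + g x)"
  "comp_fun f \<Longrightarrow> comp_fun g \<Longrightarrow> comp_fun (\<lambda>x. f x - g x)"
  "comp_fun f \<Longrightarrow> comp_fun g \<Longrightarrow> comp_fun (\<lambda>x. cpair (f x) (g x))"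
  "comp_fun f \<Longrightarrow> comp_fun (\<lambda>x. cfst (f x))"
  "comp_fun f \<Longrightarrow> comp_fun (\<lambda>x. csnd (f x))"
  unfolding comp_fun_def
  by (auto intro: computable_nth computable_const computable_Suc computable_add computable_diff
      computable_cpair computable_cfst computable_csnd)

lemma comp_fun_comp: "comp_fun f \<Longrightarrow> comp_fun g \<Longrightarrow> comp_fun (\<lambda>x. f (g x))"
  unfolding comp_fun_def by (rule computable_comp1)

text \<open>The body of a binder sees its enclosing argument and its bound variables packed into a single
  number, so that all rules concern unary functions only.\<close>
lemma comp_rec_nat:
  assumes "comp_fun a" "comp_fun m" "comp_fun (\<lambda>z. b (cfst z) (cfst (csnd z)) (csnd (csnd z)))"
  shows "comp_fun (\<lambda>x. rec_nat (a x) (\<lambda>n y. b x n y) (m x))"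
proof -
  let ?b = "\<lambda>z. b (cfst z) (cfst (csnd z)) (csnd (csnd z))"
  let ?c = "\<lambda>ys. ?b (cpair (ys ! 2) (cpair (ys ! 1) (ys ! 0)))"
  have "computable (Suc (Suc 1)) ?c"
    by (rule computable_comp1[OF assms(3)[unfolded comp_fun_def]])
      (intro computable_cpair computable_nth; simp)
  from computable_rec_nat[OF assms(1)[unfolded comp_fun_def] this assms(2)[unfolded comp_fun_def]]
  show ?thesis unfolding comp_fun_def by simp
qed

text \<open>A conditional is a recursion with one round if \<open>P x\<close> holds and none
  otherwise.\<close>

lemma comp_if [comp_intros]:
  assumes "comp_pred P" "comp_fun f" "comp_fun g"
  shows "comp_fun (\<lambda>x. if P x then f x else g x)"
proof -
  have "comp_fun (\<lambda>x. rec_nat (g x) (\<lambda>n y. f x) (of_bool (P x)))"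
    by (rule comp_rec_nat)
      (use assms in \<open>auto simp: comp_pred_def intro!: comp_fun_comp[of f "\<lambda>z. cfst z"] comp_basic\<close>)
  moreover have "rec_nat (g x) (\<lambda>n y. f x) (of_bool (P x)) = (if P x then f x else g x)" for x
    by simp
  ultimately show ?thesis by simp
qed

lemma comp_pred_eq [comp_intros]:
  assumes "comp_fun f" "comp_fun g"
  shows "comp_pred (\<lambda>x. f x = g x)"
proof -
  have "comp_fun (\<lambda>x. 1 - ((f x - g x) + (g x - f x)))" using assms by (intro comp_intros)
  moreover have "1 - ((f x - g x) + (g x - f x)) = of_bool (f x = g x)" for x by auto
  ultimately show ?thesis unfolding comp_pred_def by simp
qed

lemma comp_pred_not [comp_intros]:
  assumes "comp_pred P"
  shows "comp_pred (\<lambda>x. \<not> P x)"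
proof -
  have "comp_fun (\<lambda>x. if P x then 0 else 1)" using assms by (intro comp_intros)
  moreover have "(if P x then 0 else 1) = (of_bool (\<not> P x) :: nat)" for x by simp
  ultimately show ?thesis unfolding comp_pred_def by simp
qed

lemma comp_pred_conj [comp_intros]:
  assumes "comp_pred P" "comp_pred Q"
  shows "comp_pred (\<lambda>x. P x \<and> Q x)"
proof -
  have "comp_fun (\<lambda>x. if P x then of_bool (Q x) else 0)"
    using assms by (intro comp_intros) (simp_all add: comp_pred_def)
  moreover have "(if P x then of_bool (Q x) else 0) = (of_bool (P x \<and> Q x) :: nat)" for x by simp
  ultimately show ?thesis unfolding comp_pred_def by simp
qed

lemma comp_pred_disj [comp_intros]:
  assumes "comp_pred P" "comp_pred Q"
  shows "comp_pred (\<lambda>x. P x \<or> Q x)"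
proof -
  have "comp_pred (\<lambda>x. \<not> (\<not> P x \<and> \<not> Q x))" using assms by (intro comp_intros)
  then show ?thesis by simp
qed

lemma length_le_list_encode: "length xs \<le> list_encode xs"
proof (induction xs)
  case (Cons x xs)
  then show ?case using le_prod_encode_2[of "list_encode xs" x] by simp
qed simp

text \<open>The fold becomes an iteration on pairs of an accumulator and the code of the remaining
  list. The list code itself serves as the number of rounds: it is at least the length, and surplus
  rounds change nothing.\<close>

lemma comp_foldl:
  assumes "comp_fun a" "comp_fun l" "comp_fun (\<lambda>z. f (cfst z) (cfst (csnd z)) (csnd (csnd z)))"
  shows "comp_fun (\<lambda>x. foldl (\<lambda>y e. f x y e) (a x) (list_decode (l x)))"
proof -
  \<comment> \<open>The empty list has code 0; any other list code is the successor of the pair of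
    head and tail code.\<close>
  define step where "step x s = (if csnd s = 0 then s
    else cpair (f x (cfst s) (cfst (csnd s - 1))) (csnd (csnd s - 1)))" for x s
  have iter: "rec_nat (cpair y0 (list_encode es)) (\<lambda>_ s. step x s) n =
      cpair (foldl (\<lambda>y e. f x y e) y0 (take n es)) (list_encode (drop n es))" for x y0 es n
  proof (induction n)
    case (Suc n)
    show ?case
    proof (cases "n < length es")
      case True
      then have "drop n es = es ! n # drop (Suc n) es" "take (Suc n) es = take n es @ [es ! n]"
        by (simp_all add: Cons_nth_drop_Suc take_Suc_conv_app_nth)
      then show ?thesis by (simp add: Suc) (simp add: step_def)
    qed (simp add: Suc, simp add: step_def)
  qed simp
  have f: "comp_fun (\<lambda>z. f (u z) (v z) (w z))" if "comp_fun u" "comp_fun v" "comp_fun w" for u v w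
    using comp_fun_comp[OF assms(3), of "\<lambda>z. cpair (u z) (cpair (v z) (w z))"] that
    by (simp add: comp_basic)
  have "comp_fun (\<lambda>x. cfst (rec_nat (cpair (a x) (l x)) (\<lambda>_ s. step x s) (l x)))"
    unfolding step_def by (intro comp_intros comp_rec_nat f assms)
  moreover have "cfst (rec_nat (cpair (a x) (l x)) (\<lambda>_ s. step x s) (l x)) =
      foldl (\<lambda>y e. f x y e) (a x) (list_decode (l x))" for x
    using iter[of "a x" "list_decode (l x)" x "l x"] length_le_list_encode[of "list_decode (l x)"]
    by simp
  ultimately show ?thesis by simp
qed

abbreviation elems :: "nat \<Rightarrow> nat set" where "elems l \<equiv> set (list_decode l)"

lemma comp_pred_ball [comp_intros]:
  assumes "comp_fun l" "comp_pred (\<lambda>z. P (cfst z) (csnd z))"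
  shows "comp_pred (\<lambda>x. \<forall>e \<in> elems (l x). P x e)"
proof -
  have P: "comp_pred (\<lambda>z. P (u z) (v z))" if "comp_fun u" "comp_fun v" for u v
    using comp_fun_comp[OF assms(2)[unfolded comp_pred_def], of "\<lambda>z. cpair (u z) (v z)"] that
    by (simp add: comp_basic comp_pred_def)
  have "comp_fun (\<lambda>x. foldl (\<lambda>y e. if P x e then y else 0) 1 (list_decode (l x)))"
    by (intro comp_foldl comp_intros P assms)
  moreover have "foldl (\<lambda>y e. if P x e then y else 0) y es =
      (if \<forall>e \<in> set es. P x e then y else 0)" for x es and y :: nat
    by (induction es arbitrary: y) auto
  ultimately have "comp_fun (\<lambda>x. if \<forall>e \<in> elems (l x). P x e then 1 else 0)" by (simp only:)
  then show ?thesis unfolding comp_pred_def of_bool_def .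
qed

lemma comp_pred_bex [comp_intros]:
  assumes "comp_fun l" "comp_pred (\<lambda>z. P (cfst z) (csnd z))"
  shows "comp_pred (\<lambda>x. \<exists>e \<in> elems (l x). P x e)"
proof -
  have "comp_pred (\<lambda>x. \<not> (\<forall>e \<in> elems (l x). \<not> P x e))" using assms by (intro comp_intros)
  then show ?thesis by simp
qed

lemma comp_pred_mem [comp_intros]:
  assumes "comp_fun f" "comp_fun l"
  shows "comp_pred (\<lambda>x. f x \<in> elems (l x))"
proof -
  have "comp_fun (\<lambda>z. f (cfst z))" by (rule comp_fun_comp[OF assms(1)]) (intro comp_intros)
  then have "comp_pred (\<lambda>x. \<exists>e \<in> elems (l x). e = f x)" by (intro comp_intros assms(2))
  then show ?thesis by simp
qed

section \<open>Lists, transitions and protocols as numbers\<close>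

definition snoc_code :: "nat \<Rightarrow> nat \<Rightarrow> nat" where
  "snoc_code l b = list_encode (list_decode l @ [b])"

text \<open>Folding with cons reverses a list, and appending at the end is cons between two
  reversals.\<close>

lemma comp_snoc_code [comp_intros]:
  assumes "comp_fun f" "comp_fun g"
  shows "comp_fun (\<lambda>x. snoc_code (f x) (g x))"
proof -
  have rev: "foldl (\<lambda>y e. Suc (cpair e y)) (list_encode ys) es = list_encode (rev es @ ys)" for es ys
    by (induction es arbitrary: ys) (simp_all flip: list_encode.simps(2))
  have C: "comp_fun (\<lambda>x. list_encode (rev (list_decode (h x))))" if "comp_fun h" for h
  proof -
    have "comp_fun (\<lambda>x. foldl (\<lambda>y e. Suc (cpair e y)) 0 (list_decode (h x)))"
      by (intro comp_foldl comp_intros that)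
    then show ?thesis using rev[of "[]"] by simp
  qed
  have "comp_fun (\<lambda>x. list_encode (rev (list_decode (Suc (cpair (g x) (list_encode (rev (list_decode (f x)))))))))"
    by (intro C comp_intros assms)
  then show ?thesis unfolding snoc_code_def by simp
qed

definition hd_code :: "nat \<Rightarrow> nat" where "hd_code l = cfst (l - 1)"
definition tl_code :: "nat \<Rightarrow> nat" where "tl_code l = csnd (l - 1)"

lemma hd_tl_code [simp]:
  "hd_code (Suc (cpair x l)) = x" "tl_code (Suc (cpair x l)) = l"
  by (simp_all add: hd_code_def tl_code_def)

lemma comp_hd_code [comp_intros]: "comp_fun f \<Longrightarrow> comp_fun (\<lambda>x. hd_code (f x))"
  unfolding hd_code_def by (intro comp_intros)

lemma comp_tl_code [comp_intros]: "comp_fun f \<Longrightarrow> comp_fun (\<lambda>x. tl_code (f x))"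
  unfolding tl_code_def by (intro comp_intros)

definition t_src :: "nat \<Rightarrow> nat" where "t_src t = hd_code t"
definition t_sign :: "nat \<Rightarrow> nat" where "t_sign t = hd_code (tl_code t)"
definition t_msg :: "nat \<Rightarrow> nat" where "t_msg t = hd_code (tl_code (tl_code t))"
definition t_tgt :: "nat \<Rightarrow> nat" where "t_tgt t = hd_code (tl_code (tl_code (tl_code t)))"

text \<open>In the code of a pair the two machines follow the two alphabets; in the code of a
  machine the initial state and the transitions follow the list of states.\<close>

definition init0 :: "nat \<Rightarrow> nat" where "init0 x = hd_code (tl_code (hd_code (tl_code (tl_code x))))"
definition init1 :: "nat \<Rightarrow> nat" where "init1 x = hd_code (tl_code (hd_code (tl_code (tl_code (tl_code x)))))"
definition trans0 :: "nat \<Rightarrow> nat" where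
  "trans0 x = hd_code (tl_code (tl_code (hd_code (tl_code (tl_code x)))))"
definition trans1 :: "nat \<Rightarrow> nat" where
  "trans1 x = hd_code (tl_code (tl_code (hd_code (tl_code (tl_code (tl_code x))))))"

lemmas code_access_defs = t_src_def t_sign_def t_msg_def t_tgt_def init0_def init1_def trans0_def trans1_def

lemma t_access [simp]:
  "t_src (encode_trans (p, (s, b), q)) = p" "t_sign (encode_trans (p, (s, b), q)) = of_bool s"
  "t_msg (encode_trans (p, (s, b), q)) = b" "t_tgt (encode_trans (p, (s, b), q)) = q"
  by (simp_all add: code_access_defs encode_trans_def)

lemma pair_access [simp]:
  "init0 (encode_pair P) = init (mach0 P)" "init1 (encode_pair P) = init (mach1 P)"
  "list_decode (trans0 (encode_pair P)) = map encode_trans (trans (mach0 P))"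
  "list_decode (trans1 (encode_pair P)) = map encode_trans (trans (mach1 P))"
  by (simp_all add: code_access_defs encode_pair_def encode_fsm_def)

lemma comp_access [comp_intros]:
  assumes "comp_fun f"
  shows "comp_fun (\<lambda>x. t_src (f x))" "comp_fun (\<lambda>x. t_sign (f x))"
    "comp_fun (\<lambda>x. t_msg (f x))" "comp_fun (\<lambda>x. t_tgt (f x))"
    "comp_fun (\<lambda>x. init0 (f x))" "comp_fun (\<lambda>x. init1 (f x))"
    "comp_fun (\<lambda>x. trans0 (f x))" "comp_fun (\<lambda>x. trans1 (f x))"
  unfolding code_access_defs by (intro comp_intros assms)+

section \<open>Simulation of global steps on codes\<close>

definition gcode :: "gstate \<Rightarrow> nat" where
  "gcode c = cpair (cpair (fst (fst c)) (snd (fst c)))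
     (cpair (list_encode (fst (snd c))) (list_encode (snd (snd c))))"

abbreviation c_state0 :: "nat \<Rightarrow> nat" where "c_state0 c \<equiv> cfst (cfst c)"
abbreviation c_state1 :: "nat \<Rightarrow> nat" where "c_state1 c \<equiv> csnd (cfst c)"
abbreviation c_chan0 :: "nat \<Rightarrow> nat" where "c_chan0 c \<equiv> cfst (csnd c)"
abbreviation c_chan1 :: "nat \<Rightarrow> nat" where "c_chan1 c \<equiv> csnd (csnd c)"

lemma inj_gcode: "inj gcode"
  by (rule injI) (auto simp: gcode_def list_encode_eq prod_eq_iff)

text \<open>Executing a transition that is not enabled leaves the global state unchanged, so every
  transition sequence leads to a reachable state.\<close>
definition exec0 :: "nat \<Rightarrow> nat \<Rightarrow> nat \<Rightarrow> nat" where
  "exec0 x c t = (if t \<in> elems (trans0 x) \<and> t_src t = c_state0 c then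
     (if t_sign t = 1 then
        cpair (cpair (t_tgt t) (c_state1 c)) (cpair (snoc_code (c_chan0 c) (t_msg t)) (c_chan1 c))
      else if c_chan1 c \<noteq> 0 \<and> hd_code (c_chan1 c) = t_msg t then
        cpair (cpair (t_tgt t) (c_state1 c)) (cpair (c_chan0 c) (tl_code (c_chan1 c)))
      else c) else c)"

definition exec1 :: "nat \<Rightarrow> nat \<Rightarrow> nat \<Rightarrow> nat" where
  "exec1 x c t = (if t \<in> elems (trans1 x) \<and> t_src t = c_state1 c then
     (if t_sign t = 1 then
        cpair (cpair (c_state0 c) (t_tgt t)) (cpair (c_chan0 c) (snoc_code (c_chan1 c) (t_msg t)))
      else if c_chan0 c \<noteq> 0 \<and> hd_code (c_chan0 c) = t_msg t then
        cpair (cpair (c_state0 c) (t_tgt t)) (cpair (tl_code (c_chan0 c)) (c_chan1 c))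
      else c) else c)"

text \<open>A move \<open>e\<close> is a pair: \<open>cfst e\<close> selects the machine, 0 for the
  first and anything else for the second, and \<open>csnd e\<close> is the code of the
  transition.\<close>

definition exec :: "nat \<Rightarrow> nat \<Rightarrow> nat \<Rightarrow> nat" where
  "exec x c e = (if cfst e = 0 then exec0 x c (csnd e) else exec1 x c (csnd e))"

lemma comp_exec [comp_intros]:
  assumes "comp_fun f" "comp_fun g" "comp_fun h"
  shows "comp_fun (\<lambda>x. exec0 (f x) (g x) (h x))" "comp_fun (\<lambda>x. exec1 (f x) (g x) (h x))"
    "comp_fun (\<lambda>x. exec (f x) (g x) (h x))"
  unfolding exec_def exec0_def exec1_def by (intro comp_intros assms)+

section \<open>Certificates\<close>

definition dead_code :: "nat \<Rightarrow> nat \<Rightarrow> bool" where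
  "dead_code x c \<longleftrightarrow> (\<forall>t \<in> elems (trans0 x). \<not> (t_src t = c_state0 c \<and> t_sign t = 1)) \<and>
     (\<forall>t \<in> elems (trans1 x). \<not> (t_src t = c_state1 c \<and> t_sign t = 1)) \<and>
     c_chan0 c = 0 \<and> c_chan1 c = 0"

definition burst_code :: "nat \<Rightarrow> nat \<Rightarrow> bool" where
  "burst_code T n \<longleftrightarrow> n \<noteq> 0 \<and>
     (\<forall>p \<in> elems n. \<exists>t \<in> elems T. t_src t = p \<and> t_sign t = 1 \<and> t_tgt t \<in> elems n)"

definition init_code :: "nat \<Rightarrow> nat" where
  "init_code x = cpair (cpair (init0 x) (init1 x)) (cpair 0 0)"

text \<open>\<open>n\<close> lists a finite inductive invariant that excludes deadlocks.\<close>

definition yes_cert :: "nat \<Rightarrow> nat \<Rightarrow> bool" where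
  "yes_cert x n \<longleftrightarrow> init_code x \<in> elems n \<and> (\<forall>c \<in> elems n. \<not> dead_code x c \<and>
     (\<forall>t \<in> elems (trans0 x). exec0 x c t \<in> elems n) \<and>
     (\<forall>t \<in> elems (trans1 x). exec1 x c t \<in> elems n))"

text \<open>The same number is read as a sequence of moves in the first alternative and as a list of
  states in the other two.\<close>

definition no_cert :: "nat \<Rightarrow> nat \<Rightarrow> bool" where
  "no_cert x n \<longleftrightarrow> dead_code x (foldl (\<lambda>c e. exec x c e) (init_code x) (list_decode n)) \<or>
     burst_code (trans0 x) n \<or> burst_code (trans1 x) n"

lemma comp_certs:
  "comp_pred (\<lambda>z. yes_cert (cfst z) (csnd z))" "comp_pred (\<lambda>z. no_cert (cfst z) (csnd z))"
  unfolding yes_cert_def no_cert_def dead_code_def burst_code_def init_code_def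
  by (intro comp_intros comp_foldl)+

section \<open>Correctness of the certificates\<close>

lemma exec0_sound:
  "\<exists>d. exec0 (encode_pair P) (gcode c) t = gcode d \<and> (d = c \<or> gstep P c d)"
proof (cases "exec0 (encode_pair P) (gcode c) t = gcode c")
  case False
  obtain p0 p1 xa xb where c: "c = ((p0, p1), (xa, xb))" by (metis prod.collapse)
  have "t \<in> elems (trans0 (encode_pair P))" "t_src t = p0"
    using False unfolding exec0_def by (auto simp: c gcode_def split: if_splits)
  then obtain s b q where t: "t = encode_trans (p0, (s, b), q)"
    and tr: "(p0, (s, b), q) \<in> set (trans (mach0 P))" by auto
  show ?thesis
  proof (cases s)
    case True
    then have "exec0 (encode_pair P) (gcode c) t = gcode ((q, p1), (xa @ [b], xb))"
      using tr by (auto simp: exec0_def t c gcode_def snoc_code_def)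
    moreover have "gstep P c ((q, p1), (xa @ [b], xb))" using gstep.send0 tr True c by simp
    ultimately show ?thesis by blast
  next
    case s: False
    show ?thesis
    proof (cases "\<exists>xb'. xb = b # xb'")
      case True
      then obtain xb' where xb: "xb = b # xb'" by blast
      then have "exec0 (encode_pair P) (gcode c) t = gcode ((q, p1), (xa, xb'))"
        using tr s by (auto simp: exec0_def t c gcode_def)
      moreover have "gstep P c ((q, p1), (xa, xb'))" using gstep.recv0 tr s c xb by simp
      ultimately show ?thesis by blast
    next
      case nb: False
      then have "exec0 (encode_pair P) (gcode c) t = gcode c"
        using s by (cases xb) (auto simp: exec0_def t c gcode_def)
      then show ?thesis using False by simp
    qed
  qed
qed blast

lemma exec1_sound:
  "\<exists>d. exec1 (encode_pair P) (gcode c) t = gcode d \<and> (d = c \<or> gstep P c d)"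
proof (cases "exec1 (encode_pair P) (gcode c) t = gcode c")
  case False
  obtain p0 p1 xa xb where c: "c = ((p0, p1), (xa, xb))" by (metis prod.collapse)
  have "t \<in> elems (trans1 (encode_pair P))" "t_src t = p1"
    using False unfolding exec1_def by (auto simp: c gcode_def split: if_splits)
  then obtain s b q where t: "t = encode_trans (p1, (s, b), q)"
    and tr: "(p1, (s, b), q) \<in> set (trans (mach1 P))" by auto
  show ?thesis
  proof (cases s)
    case True
    then have "exec1 (encode_pair P) (gcode c) t = gcode ((p0, q), (xa, xb @ [b]))"
      using tr by (auto simp: exec1_def t c gcode_def snoc_code_def)
    moreover have "gstep P c ((p0, q), (xa, xb @ [b]))" using gstep.send1 tr True c by simp
    ultimately show ?thesis by blast
  next
    case s: False
    show ?thesis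
    proof (cases "\<exists>xa'. xa = b # xa'")
      case True
      then obtain xa' where xa: "xa = b # xa'" by blast
      then have "exec1 (encode_pair P) (gcode c) t = gcode ((p0, q), (xa', xb))"
        using tr s by (auto simp: exec1_def t c gcode_def)
      moreover have "gstep P c ((p0, q), (xa', xb))" using gstep.recv1 tr s c xa by simp
      ultimately show ?thesis by blast
    next
      case nb: False
      then have "exec1 (encode_pair P) (gcode c) t = gcode c"
        using s by (cases xa) (auto simp: exec1_def t c gcode_def)
      then show ?thesis using False by simp
    qed
  qed
qed blast

lemma gstep_exec:
  assumes "gstep P c d"
  shows "(\<exists>t \<in> elems (trans0 (encode_pair P)). exec0 (encode_pair P) (gcode c) t = gcode d) \<or>
    (\<exists>t \<in> elems (trans1 (encode_pair P)). exec1 (encode_pair P) (gcode c) t = gcode d)"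
  using assms
proof cases
  case (send0 p0 b q p1 xa xb)
  then show ?thesis
    by (intro disjI1 bexI[of _ "encode_trans (p0, (True, b), q)"])
      (auto simp: exec0_def gcode_def snoc_code_def)
next
  case (recv0 p0 b q p1 xa xb)
  then show ?thesis
    by (intro disjI1 bexI[of _ "encode_trans (p0, (False, b), q)"])
      (auto simp: exec0_def gcode_def)
next
  case (send1 p1 b q p0 xa xb)
  then show ?thesis
    by (intro disjI2 bexI[of _ "encode_trans (p1, (True, b), q)"])
      (auto simp: exec1_def gcode_def snoc_code_def)
next
  case (recv1 p1 b q p0 xa xb)
  then show ?thesis
    by (intro disjI2 bexI[of _ "encode_trans (p1, (False, b), q)"])
      (auto simp: exec1_def gcode_def)
qed

lemma init_code_eq: "init_code (encode_pair P) = gcode (initial_gstate P)"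
  by (simp add: init_code_def gcode_def initial_gstate_def)

text \<open>Translates between coded and actual send transitions; \<open>R\<close> is trivial for
  deadlocks and is membership in the burst for send cycles.\<close>

lemma send_trans_code:
  "(\<exists>t \<in> encode_trans ` set (trans F). t_src t = p \<and> t_sign t = 1 \<and> R (t_tgt t)) \<longleftrightarrow>
    (\<exists>b q. (p, (True, b), q) \<in> set (trans F) \<and> R q)"
proof
  assume "\<exists>t \<in> encode_trans ` set (trans F). t_src t = p \<and> t_sign t = 1 \<and> R (t_tgt t)"
  then obtain p' s b q where "(p', (s, b), q) \<in> set (trans F)"
    and "let t = encode_trans (p', (s, b), q) in t_src t = p \<and> t_sign t = 1 \<and> R (t_tgt t)"
    by (auto simp: Let_def)
  then show "\<exists>b q. (p, (True, b), q) \<in> set (trans F) \<and> R q" by (cases s) (auto simp: Let_def)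
next
  assume "\<exists>b q. (p, (True, b), q) \<in> set (trans F) \<and> R q"
  then obtain b q where "(p, (True, b), q) \<in> set (trans F)" "R q" by blast
  then show "\<exists>t \<in> encode_trans ` set (trans F). t_src t = p \<and> t_sign t = 1 \<and> R (t_tgt t)"
    by (intro bexI[of _ "encode_trans (p, (True, b), q)"]) auto
qed

lemma dead_code_iff: "dead_code (encode_pair P) (gcode c) \<longleftrightarrow> deadlocked P c"
proof -
  have enc0: "list_encode xs = 0 \<longleftrightarrow> xs = []" for xs by (cases xs) auto
  have "(\<forall>t \<in> encode_trans ` set (trans F). \<not> (t_src t = p \<and> t_sign t = 1)) \<longleftrightarrow> receive_state F p" for F p
    using send_trans_code[of F p "\<lambda>_. True"] unfolding receive_state_def by blast
  then show ?thesis
    by (simp add: dead_code_def deadlocked_def gcode_def enc0 del: ball_simps)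
qed

lemma burst_code_iff:
  assumes "list_decode T = map encode_trans (trans F)"
  shows "burst_code T n \<longleftrightarrow> send_burst F (elems n)"
proof -
  have "n \<noteq> 0 \<longleftrightarrow> elems n \<noteq> {}" by (cases n) (auto simp: case_prod_unfold)
  moreover have "(\<exists>t \<in> elems T. t_src t = p \<and> t_sign t = 1 \<and> t_tgt t \<in> elems n) \<longleftrightarrow>
      (\<exists>b q. (p, (True, b), q) \<in> set (trans F) \<and> q \<in> elems n)" for p
    using send_trans_code by (simp only: assms set_map)
  ultimately show ?thesis by (simp add: burst_code_def send_burst_def)
qed

text \<open>Moves that are not enabled idle, so even arbitrary numbers read as moves lead to
  reachable states.\<close>

lemma foldl_exec_reachable:
  "\<exists>c. reachable P c \<and>
     foldl (\<lambda>c e. exec (encode_pair P) c e) (init_code (encode_pair P)) es = gcode c"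
proof (induction es rule: rev_induct)
  case Nil
  show ?case by (intro exI[of _ "initial_gstate P"]) (simp add: init_code_eq reachable_def)
next
  case (snoc e es)
  then obtain c where c: "reachable P c"
    "foldl (\<lambda>c e. exec (encode_pair P) c e) (init_code (encode_pair P)) es = gcode c" by blast
  obtain d where "exec (encode_pair P) (gcode c) e = gcode d" "d = c \<or> gstep P c d"
    unfolding exec_def using exec0_sound exec1_sound by (metis (full_types))
  then show ?case using c unfolding reachable_def
    by (intro exI[of _ d]) (auto intro: rtranclp.rtrancl_into_rtrancl)
qed

lemma reachable_foldl_exec:
  assumes "reachable P c"
  shows "\<exists>es. foldl (\<lambda>c e. exec (encode_pair P) c e) (init_code (encode_pair P)) es = gcode c"
  using assms unfolding reachable_def
proof (induction rule: rtranclp_induct)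
  case base
  show ?case by (intro exI[of _ "[]"]) (simp add: init_code_eq)
next
  case (step c d)
  then obtain es where es: "foldl (\<lambda>c e. exec (encode_pair P) c e) (init_code (encode_pair P)) es = gcode c"
    by blast
  have "\<exists>e. exec (encode_pair P) (gcode c) e = gcode d"
    using gstep_exec[OF step(2)]
  proof (elim disjE bexE)
    fix t assume "exec0 (encode_pair P) (gcode c) t = gcode d"
    then show ?thesis by (intro exI[of _ "cpair 0 t"]) (simp add: exec_def)
  next
    fix t assume "exec1 (encode_pair P) (gcode c) t = gcode d"
    then show ?thesis by (intro exI[of _ "cpair 1 t"]) (simp add: exec_def)
  qed
  then obtain e where "exec (encode_pair P) (gcode c) e = gcode d" by blast
  then show ?case using es by (intro exI[of _ "es @ [e]"]) simp
qed

text \<open>All reachable states have their codes in \<open>n\<close>. As \<open>gcode\<close> is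
  injective, there are finitely many of them, and the maximal channel content bounds the
  channels.\<close>

lemma yes_cert_sound:
  assumes "yes_cert (encode_pair P) n"
  shows "deadlock_free P \<and> bounded_channels P"
proof -
  note cert = assms[unfolded yes_cert_def]
  have mem: "gcode c \<in> elems n" if "reachable P c" for c
    using that unfolding reachable_def
  proof (induction rule: rtranclp_induct)
    case base
    show ?case using cert by (simp add: init_code_eq)
  next
    case (step c d)
    show ?case using gstep_exec[OF step(2)] cert step(3) by metis
  qed
  then have "{c. reachable P c} \<subseteq> gcode -` elems n" by auto
  then have fin: "finite {c. reachable P c}"
    using finite_vimageI[OF _ inj_gcode] finite_subset by blast
  let ?N = "Max ((\<lambda>c. length (fst (snd c)) + length (snd (snd c))) ` {c. reachable P c})"
  have "length (fst (snd c)) + length (snd (snd c)) \<le> ?N" if "reachable P c" for c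
    by (rule Max_ge) (use fin that in auto)
  then have "bounded_channels P" unfolding bounded_channels_def by blast
  moreover have "deadlock_free P"
    unfolding deadlock_free_def using mem cert dead_code_iff by blast
  ultimately show ?thesis by blast
qed

text \<open>Only finitely many states and messages ever occur, and there are finitely many words of
  bounded length over a finite set.\<close>

lemma bounded_finite_reachable:
  assumes "bounded_channels P"
  shows "finite {c. reachable P c}"
proof -
  obtain N where N: "\<And>c. reachable P c \<Longrightarrow> length (fst (snd c)) + length (snd (snd c)) \<le> N"
    using assms unfolding bounded_channels_def by blast
  define T where "T = set (trans (mach0 P)) \<union> set (trans (mach1 P))"
  \<comment> \<open>The initial states are added because they may not be the target of any
    transition.\<close>
  define Q where "Q = {init (mach0 P), init (mach1 P)} \<union> (\<lambda>t. snd (snd t)) ` T"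
  define M where "M = (\<lambda>t. snd (fst (snd t))) ` T"
  have tr: "q \<in> Q \<and> b \<in> M" if "(p, (s, b), q) \<in> set (trans (mach0 P)) \<or> (p, (s, b), q) \<in> set (trans (mach1 P))"
    for p s b q using that unfolding Q_def M_def T_def by force
  have inv: "fst (fst c) \<in> Q \<and> snd (fst c) \<in> Q \<and> set (fst (snd c)) \<subseteq> M \<and> set (snd (snd c)) \<subseteq> M"
    if "reachable P c" for c
    using that unfolding reachable_def
  proof (induction rule: rtranclp_induct)
    case base
    show ?case by (simp add: initial_gstate_def Q_def)
  next
    case (step c d)
    from step(2,3) tr show ?case by cases auto
  qed
  let ?L = "{xs. set xs \<subseteq> M \<and> length xs \<le> N}"
  have "finite T" by (simp add: T_def)
  then have "finite ((Q \<times> Q) \<times> (?L \<times> ?L))"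
    by (intro finite_cartesian_product finite_lists_length_le) (simp_all add: Q_def M_def)
  moreover have "{c. reachable P c} \<subseteq> (Q \<times> Q) \<times> (?L \<times> ?L)"
  proof
    fix c assume "c \<in> {c. reachable P c}"
    then show "c \<in> (Q \<times> Q) \<times> (?L \<times> ?L)" using inv[of c] N[of c] by (cases c) auto
  qed
  ultimately show ?thesis by (rule finite_subset[rotated])
qed

text \<open>The reachable states themselves, listed in any order, form the certificate.\<close>

lemma yes_cert_complete:
  assumes "deadlock_free P" "bounded_channels P"
  shows "\<exists>n. yes_cert (encode_pair P) n"
proof -
  obtain cs where cs: "set cs = {c. reachable P c}"
    using finite_list[OF bounded_finite_reachable[OF assms(2)]] by blast
  define n where "n = list_encode (map gcode cs)"
  have n: "elems n = gcode ` {c. reachable P c}" by (simp add: n_def cs)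
  have cl: "gcode d \<in> elems n" if "reachable P c" "d = c \<or> gstep P c d" for c d
    using that unfolding n reachable_def by (auto intro: rtranclp.rtrancl_into_rtrancl)
  have "init_code (encode_pair P) \<in> elems n" by (auto simp: n init_code_eq reachable_def)
  moreover have "\<not> dead_code (encode_pair P) (gcode c) \<and> exec0 (encode_pair P) (gcode c) t \<in> elems n \<and>
      exec1 (encode_pair P) (gcode c) t \<in> elems n" if c: "reachable P c" for c t
  proof (intro conjI)
    show "\<not> dead_code (encode_pair P) (gcode c)"
      using assms(1) c unfolding dead_code_iff deadlock_free_def by blast
    show "exec0 (encode_pair P) (gcode c) t \<in> elems n" using exec0_sound[of P c t] cl[OF c] by auto
    show "exec1 (encode_pair P) (gcode c) t \<in> elems n" using exec1_sound[of P c t] cl[OF c] by auto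
  qed
  ultimately have "yes_cert (encode_pair P) n" unfolding yes_cert_def using n by auto
  then show ?thesis by blast
qed

lemma no_cert_iff:
  assumes "is_SR_pair P" "affine P"
  shows "(\<exists>n. no_cert (encode_pair P) n) \<longleftrightarrow> \<not> (deadlock_free P \<and> bounded_channels P)"
proof -
  have dead: "(\<exists>n. dead_code (encode_pair P) (foldl (\<lambda>c e. exec (encode_pair P) c e)
      (init_code (encode_pair P)) (list_decode n))) \<longleftrightarrow> \<not> deadlock_free P"
    unfolding deadlock_free_def
    by (metis dead_code_iff foldl_exec_reachable reachable_foldl_exec list_encode_inverse)
  have sr: "sr_fsm (mach0 P)" "sr_fsm (mach1 P)"
    using assms(1) SR_machine_sr_fsm unfolding is_SR_pair_def by blast+
  have burst: "(\<exists>n. burst_code T n) \<longleftrightarrow> (\<exists>L \<subseteq> set (states F). send_burst F L)"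
    if T: "list_decode T = map encode_trans (trans F)" and F: "sr_fsm F" for T F
  proof
    assume "\<exists>n. burst_code T n"
    then obtain n where n: "send_burst F (elems n)" using burst_code_iff[OF T] by blast
    \<comment> \<open>Every member of a burst is the source of a transition, hence a state of the
      machine.\<close>
    then have "elems n \<subseteq> set (states F)"
      using sr_fsm.trans_states[OF F] unfolding send_burst_def by blast
    then show "\<exists>L \<subseteq> set (states F). send_burst F L" using n by blast
  next
    assume "\<exists>L \<subseteq> set (states F). send_burst F L"
    then obtain L where L: "L \<subseteq> set (states F)" "send_burst F L" by blast
    obtain ls where "set ls = L" using finite_list finite_subset[OF L(1)] by blast
    then have "burst_code T (list_encode ls)" using L(2) burst_code_iff[OF T] by simp
    then show "\<exists>n. burst_code T n" by blast
  qed
  show ?thesis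
    unfolding no_cert_def ex_disj_distrib dead burst[OF pair_access(3) sr(1)]
      burst[OF pair_access(4) sr(2)] not_deadlock_free_bounded_iff[OF assms] by blast
qed

section \<open>Search for the least certificate\<close>

theorem theorem6p4:
  shows "\<exists>alg :: recf. \<forall>P. is_SR_pair P \<and> affine P \<longrightarrow>
           reval alg [encode_pair P]
             (if deadlock_free P \<and> bounded_channels P then 1 else 0)"
proof -
  \<comment> \<open>\<open>Mu\<close> puts the search variable first, hence the argument order
    \<open>[n, x]\<close>.\<close>
  have binary: "\<exists>r. \<forall>n x. reval r [n, x] (of_bool (Q x n))"
    if "comp_pred (\<lambda>z. Q (cfst z) (csnd z))" for Q
  proof -
    have "computable 2 (\<lambda>xs. cpair (xs ! 1) (xs ! 0))"
      by (intro computable_cpair computable_nth) auto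
    from computable_comp1[OF that[unfolded comp_pred_def comp_fun_def] this]
    obtain r where r: "\<And>xs. length xs = 2 \<Longrightarrow> reval r xs (of_bool (Q (xs ! 1) (xs ! 0)))"
      unfolding computable_def by auto
    have "reval r [n, x] (of_bool (Q x n))" for n x using r[of "[n, x]"] by simp
    then show ?thesis by blast
  qed
  \<comment> \<open>The negation makes \<open>search\<close> return 0 exactly on certificates, as
    \<open>Mu\<close> requires.\<close>
  obtain search where search:
    "\<And>n x. reval search [n, x] (of_bool (\<not> (yes_cert x n \<or> no_cert x n)))"
    using binary[of "\<lambda>x n. \<not> (yes_cert x n \<or> no_cert x n)"]
      comp_pred_not[OF comp_pred_disj[OF comp_certs]] by blast
  obtain out where out: "\<And>n x. reval out [n, x] (of_bool (yes_cert x n))"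
    using binary[OF comp_certs(1)] by blast
  \<comment> \<open>The program finds the least certificate and reports whether it is a positive
    one.\<close>
  have "reval (Comp out [Mu search, Proj 0]) [encode_pair P]
      (if deadlock_free P \<and> bounded_channels P then 1 else 0)"
    if P: "is_SR_pair P" "affine P" for P
  proof -
    let ?x = "encode_pair P"
    let ?cert = "\<lambda>n. yes_cert ?x n \<or> no_cert ?x n"
    define n where "n = (LEAST n. ?cert n)"
    have "\<exists>n. ?cert n" using yes_cert_complete[of P] no_cert_iff[OF P] by blast
    then have n: "?cert n" unfolding n_def by (rule LeastI_ex)
    \<comment> \<open>The number found may be of either kind: a positive certificate proves the
      property, and otherwise \<open>n\<close> is a negative one and refutes it.\<close>
    have ans: "yes_cert ?x n \<longleftrightarrow> deadlock_free P \<and> bounded_channels P"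
      using n yes_cert_sound[of P n] no_cert_iff[OF P] by blast
    have "reval (Mu search) [?x] n"
    proof (rule reval_Mu)
      show "reval search [n, ?x] 0" using search[of n ?x] n by simp
      show "\<forall>m<n. \<exists>k. reval search [m, ?x] (Suc k)"
      proof (intro allI impI)
        fix m assume "m < n"
        then have "\<not> ?cert m" unfolding n_def by (rule not_less_Least)
        then show "\<exists>k. reval search [m, ?x] (Suc k)" using search[of m ?x] by auto
      qed
    qed
    moreover have "reval (Proj 0) [?x] ?x" using reval_Proj[of 0 "[?x]"] by simp
    ultimately have "reval (Comp out [Mu search, Proj 0]) [?x] (of_bool (yes_cert ?x n))"
      by (intro reval_Comp[where ys = "[n, ?x]"]) (auto simp: less_Suc_eq out)
    then show ?thesis by (simp add: ans of_bool_def)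
  qed
  then show ?thesis by blast
qed

end
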